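(* Let $1\le r\le K\le d$ and let $\bm{A}\in\mathbb{R}^{d\times K}$ have rank $r$ with SVD $\bm{A}=\bm{U}_{\bm{A}}\bm{\Sigma}_{\bm{A}}\bm{V}_{\bm{A}}^T$, where $\bm{U}_{\bm{A}}\in\mathcal{O}^d$, $\bm{V}_{\bm{A}}\in\mathcal{O}^K$, $\bm{\Sigma}_{\bm{A}}=\begin{bmatrix}\operatorname{diag}(a_1,\ldots,a_r)&\bm{0}\\\bm{0}&\bm{0}\end{bmatrix}$ and $a_1\ge\cdots\ge a_r>0$. Suppose there are indices $0=s_0<s_1<\cdots<s_p=r$ such that $a_{s_{i-1}+1}=\cdots=a_{s_i}$ for each $i$ and $a_{s_1}>\cdots>a_{s_p}$, and let $h_i=s_i-s_{i-1}$. Define $R(\bm{Q})=\bm{A}-\bm{Q}\bm{A}^T\bm{Q}$, and for $\bm{q}\in\{\pm1\}^r$ let $$\mathcal{Q}_{\bm{q}}=\left\{\begin{bmatrix}\bm{U}\operatorname{diag}(\bm{q})\bm{U}^T&\bm{0}\\\bm{0}&\bm{V}\end{bmatrix}:\bm{U}=\operatorname{blkdiag}(\bm{U}_1,\ldots,\bm{U}_p),\ \bm{U}_i\in\mathcal{O}^{h_i},\ \bm{V}\in{\rm St}(d-r,K-r)\right\}$$ and $\bar{\mathcal{Q}}_{\bm{q}}=\{\bm{U}_{\bm{A}}\bm{W}\bm{V}_{\bm{A}}^T:\bm{W}\in\mathcal{Q}_{\bm{q}}\}$. Let $\delta_{ij}=\frac{a_{s_i}}{a_{s_j}}-\frac{a_{s_j}}{a_{s_i}}$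 for $i\ne j$, and $$\kappa=\frac1{a_r}\left(13+6(6p-5)\Big(\min_{i,j\in\{1,\ldots,p\},\,i\ne j}\delta_{ij}^2\Big)^{-1}\right)^{1/2}.$$ Then for every $\bm{q}\in\{\pm1\}^r$, $$\operatorname{dist}(\bm{Q},\bar{\mathcal{Q}}_{\bm{q}})\le\kappa\|R(\bm{Q})\|_F\quad\text{for all }\bm{Q}\in{\rm St}(d,K)\text{ with }\operatorname{dist}(\bm{Q},\bar{\mathcal{Q}}_{\bm{q}})<1.$$
   Context: $\mathcal{O}^m$ is the set of $m\times m$ orthogonal matrices; ${\rm St}(m,k)=\{\bm{V}\in\mathbb{R}^{m\times k}:\bm{V}^T\bm{V}=\bm{I}_k\}$; $\operatorname{blkdiag}$ is the block diagonal matrix; $\operatorname{dist}(\bm{Q},\mathcal{S})=\inf_{\bm{W}\in\mathcal{S}}\|\bm{Q}-\bm{W}\|_F$. When $p=1$ the minimum over the empty index set is interpreted as $+\infty$, so that its reciprocal is $0$. *)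

theory Defs
  imports "Jordan_Normal_Form.Matrix"
begin

definition orthogonal_mat :: "nat \<Rightarrow> real mat \<Rightarrow> bool" where
  "orthogonal_mat n U \<longleftrightarrow> U \<in> carrier_mat n n \<and> transpose_mat U * U = 1\<^sub>m n"

definition stiefel :: "nat \<Rightarrow> nat \<Rightarrow> real mat \<Rightarrow> bool" where
  "stiefel m k V \<longleftrightarrow> V \<in> carrier_mat m k \<and> transpose_mat V * V = 1\<^sub>m k"

definition frob_norm :: "real mat \<Rightarrow> real" where
  "frob_norm M = sqrt (\<Sum>i<dim_row M. \<Sum>j<dim_col M. (M $$ (i, j))\<^sup>2)"

definition dist_set :: "real mat \<Rightarrow> real mat set \<Rightarrow> real" where
  "dist_set Q S = Inf ((\<lambda>W. frob_norm (Q - W)) ` S)"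

fun blkdiag :: "real mat list \<Rightarrow> real mat" where
  "blkdiag [] = 0\<^sub>m 0 0"
| "blkdiag (U # Us) = four_block_mat U (0\<^sub>m (dim_row U) (dim_col (blkdiag Us)))
      (0\<^sub>m (dim_row (blkdiag Us)) (dim_col U)) (blkdiag Us)"

definition diag_mat_of :: "nat \<Rightarrow> (nat \<Rightarrow> real) \<Rightarrow> real mat" where
  "diag_mat_of n q = mat n n (\<lambda>(i, j). if i = j then q i else 0)"

text \<open>The set Q_q; s gives the block boundaries 0 = s 0 < ... < s p = r, h_i = s i - s (i-1).\<close>
definition Qset :: "nat \<Rightarrow> nat \<Rightarrow> nat \<Rightarrow> nat \<Rightarrow> (nat \<Rightarrow> nat) \<Rightarrow> (nat \<Rightarrow> real) \<Rightarrow> real mat set" where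
  "Qset d K r p s q =
     {four_block_mat (U * diag_mat_of r q * transpose_mat U) (0\<^sub>m r (K - r)) (0\<^sub>m (d - r) r) V
      | U V. (\<exists>Us. length Us = p \<and> (\<forall>i<p. orthogonal_mat (s (i + 1) - s i) (Us ! i))
                 \<and> U = blkdiag Us) \<and> stiefel (d - r) (K - r) V}"

definition Qbar :: "real mat \<Rightarrow> real mat \<Rightarrow> nat \<Rightarrow> nat \<Rightarrow> nat \<Rightarrow> nat \<Rightarrow> (nat \<Rightarrow> nat) \<Rightarrow> (nat \<Rightarrow> real) \<Rightarrow> real mat set" where
  "Qbar UA VA d K r p s q = {UA * W * transpose_mat VA | W. W \<in> Qset d K r p s q}"

definition delta_gap :: "(nat \<Rightarrow> real) \<Rightarrow> (nat \<Rightarrow> nat) \<Rightarrow> nat \<Rightarrow> nat \<Rightarrow> real" where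
  "delta_gap a s i j = a (s i) / a (s j) - a (s j) / a (s i)"

text \<open>Reciprocal of min delta_ij^2 over i ~= j in {1..p}; 0 when p = 1 (empty min = +infinity).\<close>
definition inv_min_delta_sq :: "(nat \<Rightarrow> real) \<Rightarrow> (nat \<Rightarrow> nat) \<Rightarrow> nat \<Rightarrow> real" where
  "inv_min_delta_sq a s p =
     (if p \<le> 1 then 0
      else 1 / Min {(delta_gap a s i j)\<^sup>2 | i j. i \<in> {1..p} \<and> j \<in> {1..p} \<and> i \<noteq> j})"

definition kappa :: "(nat \<Rightarrow> real) \<Rightarrow> (nat \<Rightarrow> nat) \<Rightarrow> nat \<Rightarrow> nat \<Rightarrow> real" where
  "kappa a s p r = (1 / a r) * sqrt (13 + 6 * (6 * real p - 5) * inv_min_delta_sq a s p)"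

end

theory Submission
  imports Defs "Jordan_Normal_Form.Determinant" "HOL-Analysis.L2_Norm" "HOL-Analysis.Convex"
begin

text \<open>
  Multiplying by the orthogonal factors reduces to \<open>A = \<Sigma>\<close> and \<open>X = U\<^sub>A\<^sup>T Q V\<^sub>A\<close>, split into blocks
  \<open>M, B, C, Y\<close> with \<open>M\<close> of size \<open>r \<times> r\<close>. Isometry of \<open>X\<close> gives
  \<open>\<parallel>X\<^sup>T\<Sigma> - \<Sigma>\<^sup>TX\<parallel>\<^sup>2 + \<parallel>\<Sigma>X\<^sup>T - X\<Sigma>\<^sup>T\<parallel>\<^sup>2 = 2\<parallel>R\<parallel>\<^sup>2\<close>, which controls \<open>B\<close>, \<open>C\<close> and the distance \<open>\<parallel>G\<parallel>\<close> of
  \<open>M\<close> to its symmetric block diagonal part \<open>H\<close>. Let \<open>W\<close> be a point of the orbit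
  \<open>U diag(q) U\<^sup>T\<close> nearest to \<open>H\<close>. Stationarity under plane rotations makes \<open>W\<close> commute with \<open>H\<close>,
  and pairing \<open>M\<^sup>TM + C\<^sup>TC = I\<close> with \<open>W(H - W)\<close> gives \<open>\<parallel>H - W\<parallel> \<le> \<parallel>C\<parallel> + \<parallel>G\<parallel>\<^sup>2\<close>; the
  hypothesis \<open>dist < 1\<close> enters through \<open>\<parallel>H - W\<parallel> < 1\<close>. The block \<open>Y\<close> is within \<open>\<parallel>B\<parallel>\<close> of a matrix
  with orthonormal columns, given explicitly by a feedback construction. The squared distance is thus at
  most \<open>3\<parallel>G\<parallel>\<^sup>2 + 2\<parallel>B\<parallel>\<^sup>2 + 3\<parallel>C\<parallel>\<^sup>2\<close>, well below the claimed constant.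
\<close>

section \<open>The Frobenius inner product\<close>

text \<open>The trace form \<open>tr (A^T B)\<close>. Dimensions are read off the first argument
  alone, so even symmetry asks for both arguments in the same carrier.\<close>

definition mat_inner :: "real mat \<Rightarrow> real mat \<Rightarrow> real" where
  "mat_inner A B = (\<Sum>i<dim_row A. \<Sum>j<dim_col A. A $$ (i, j) * B $$ (i, j))"

lemma mat_inner_eq:
  "A \<in> carrier_mat n m \<Longrightarrow> mat_inner A B = (\<Sum>i<n. \<Sum>j<m. A $$ (i, j) * B $$ (i, j))"
  by (auto simp: mat_inner_def)

lemma frob_norm_nonneg [simp]: "0 \<le> frob_norm A"
  by (simp add: frob_norm_def sum_nonneg)

lemma frob_norm_sq: "(frob_norm A)\<^sup>2 = mat_inner A A"
  by (simp add: frob_norm_def mat_inner_def sum_nonneg power2_eq_square)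

lemma frob_norm_sq_eq:
  "A \<in> carrier_mat n m \<Longrightarrow> (frob_norm A)\<^sup>2 = (\<Sum>i<n. \<Sum>j<m. (A $$ (i, j))\<^sup>2)"
  by (simp only: frob_norm_sq mat_inner_eq) (simp add: power2_eq_square)

lemma mat_inner_sum_pairs:
  "A \<in> carrier_mat n m \<Longrightarrow>
    mat_inner A B = (\<Sum>x\<in>{..<n} \<times> {..<m}. A $$ x * B $$ x)"
  by (simp add: mat_inner_eq sum.cartesian_product case_prod_unfold)

lemma frob_norm_L2_set:
  "A \<in> carrier_mat n m \<Longrightarrow> frob_norm A = L2_set (\<lambda>x. A $$ x) ({..<n} \<times> {..<m})"
  by (auto simp: frob_norm_def L2_set_def sum.cartesian_product case_prod_unfold)

lemma mat_inner_Cauchy_Schwarz: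
  assumes "A \<in> carrier_mat n m" "B \<in> carrier_mat n m"
  shows "\<bar>mat_inner A B\<bar> \<le> frob_norm A * frob_norm B"
proof -
  have "\<bar>mat_inner A B\<bar> \<le> (\<Sum>x\<in>{..<n} \<times> {..<m}. \<bar>A $$ x\<bar> * \<bar>B $$ x\<bar>)"
    unfolding mat_inner_sum_pairs[OF assms(1)] by (rule order_trans[OF sum_abs]) (simp add: abs_mult)
  then show ?thesis
    using L2_set_mult_ineq[of "\<lambda>x. A $$ x" "\<lambda>x. B $$ x" "{..<n} \<times> {..<m}"]
    by (simp add: frob_norm_L2_set[OF assms(1)] frob_norm_L2_set[OF assms(2)])
qed

lemma frob_norm_triangle:
  assumes "A \<in> carrier_mat n m" "B \<in> carrier_mat n m"
  shows "frob_norm (A + B) \<le> frob_norm A + frob_norm B"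
proof -
  have "L2_set (\<lambda>x. (A + B) $$ x) ({..<n} \<times> {..<m})
      = L2_set (\<lambda>x. A $$ x + B $$ x) ({..<n} \<times> {..<m})"
    using assms by (intro L2_set_cong) auto
  then show ?thesis
    using L2_set_triangle_ineq[of "\<lambda>x. A $$ x" "\<lambda>x. B $$ x" "{..<n} \<times> {..<m}"] assms
    by (simp add: frob_norm_L2_set[of _ n m])
qed

lemma frob_norm_eq_0:
  assumes "A \<in> carrier_mat n m" "frob_norm A = 0"
  shows "A = 0\<^sub>m n m"
  using assms by (intro eq_matI) (auto simp: frob_norm_L2_set L2_set_eq_0_iff)

lemma mat_inner_commute:
  "A \<in> carrier_mat n m \<Longrightarrow> B \<in> carrier_mat n m \<Longrightarrow> mat_inner A B = mat_inner B A"
  by (simp add: mat_inner_eq mult.commute)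

lemma mat_inner_add_left:
  "A \<in> carrier_mat n m \<Longrightarrow> B \<in> carrier_mat n m \<Longrightarrow> C \<in> carrier_mat n m \<Longrightarrow>
    mat_inner (A + B) C = mat_inner A C + mat_inner B C"
  by (simp add: mat_inner_eq[of _ n m] distrib_right sum.distrib)

lemma mat_inner_add_right:
  "A \<in> carrier_mat n m \<Longrightarrow> B \<in> carrier_mat n m \<Longrightarrow> C \<in> carrier_mat n m \<Longrightarrow>
    mat_inner A (B + C) = mat_inner A B + mat_inner A C"
  by (simp add: mat_inner_eq[of _ n m] distrib_left sum.distrib)

lemma mat_inner_diff_left:
  "A \<in> carrier_mat n m \<Longrightarrow> B \<in> carrier_mat n m \<Longrightarrow> C \<in> carrier_mat n m \<Longrightarrow>
    mat_inner (A - B) C = mat_inner A C - mat_inner B C"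
  by (subst (1 2 3) mat_inner_eq[of _ n m]) (auto simp: left_diff_distrib sum_subtractf)

lemma mat_inner_diff_right:
  "A \<in> carrier_mat n m \<Longrightarrow> B \<in> carrier_mat n m \<Longrightarrow> C \<in> carrier_mat n m \<Longrightarrow>
    mat_inner A (B - C) = mat_inner A B - mat_inner A C"
  by (simp add: mat_inner_eq[of _ n m] right_diff_distrib sum_subtractf)

lemma frob_norm_diff_sq:
  assumes "A \<in> carrier_mat n m" "B \<in> carrier_mat n m"
  shows "(frob_norm (A - B))\<^sup>2 = (frob_norm A)\<^sup>2 - 2 * mat_inner A B + (frob_norm B)\<^sup>2"
proof -
  have "A - B \<in> carrier_mat n m" using assms by (simp add: minus_carrier_mat)
  then show ?thesis
    using assms unfolding frob_norm_sq
    by (simp add: mat_inner_diff_left[of _ n m] mat_inner_diff_right[of _ n m]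
        mat_inner_commute[of B n m A])
qed

lemma frob_norm_add_sq:
  assumes "A \<in> carrier_mat n m" "B \<in> carrier_mat n m"
  shows "(frob_norm (A + B))\<^sup>2 = (frob_norm A)\<^sup>2 + 2 * mat_inner A B + (frob_norm B)\<^sup>2"
proof -
  have "A + B \<in> carrier_mat n m" using assms by simp
  then show ?thesis
    using assms unfolding frob_norm_sq
    by (simp add: mat_inner_add_left[of _ n m] mat_inner_add_right[of _ n m]
        mat_inner_commute[of B n m A])
qed

lemma mat_inner_transpose:
  assumes "A \<in> carrier_mat n m" "B \<in> carrier_mat n m"
  shows "mat_inner (transpose_mat A) (transpose_mat B) = mat_inner A B"
  using assms by (subst mat_inner_eq[of _ m n], simp, subst sum.swap) (simp add: mat_inner_eq)

lemma frob_norm_transpose [simp]: "frob_norm (transpose_mat A) = frob_norm A"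
  using mat_inner_transpose[of A "dim_row A" "dim_col A" A]
  by (metis carrier_mat_triv frob_norm_nonneg frob_norm_sq power2_eq_imp_eq)

lemma index_mult_mat_sum:
  "A \<in> carrier_mat n m \<Longrightarrow> B \<in> carrier_mat m k \<Longrightarrow> i < n \<Longrightarrow> j < k \<Longrightarrow>
    (A * B) $$ (i, j) = (\<Sum>l<m. A $$ (i, l) * B $$ (l, j))"
  by (simp add: scalar_prod_def lessThan_atLeast0)

text \<open>Left multiplication by \<open>A\<close> has adjoint left multiplication by
  \<open>A^T\<close>. Together with the right-hand version below, this does the work of cyclicity of
  the trace in all later pairings.\<close>

lemma mat_inner_mult_left:
  assumes "A \<in> carrier_mat n m" "B \<in> carrier_mat m k" "C \<in> carrier_mat n k"
  shows "mat_inner (A * B) C = mat_inner B (transpose_mat A * C)"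
proof -
  have "mat_inner (A * B) C = (\<Sum>i<n. \<Sum>j<k. \<Sum>l<m. A $$ (i, l) * B $$ (l, j) * C $$ (i, j))"
    using assms by (simp add: mat_inner_eq[of _ n k] index_mult_mat_sum[of A n m B k] sum_distrib_right
        del: index_mult_mat)
  also have "\<dots> = (\<Sum>l<m. \<Sum>j<k. \<Sum>i<n. B $$ (l, j) * (A $$ (i, l) * C $$ (i, j)))"
    by (subst sum.swap, subst (2) sum.swap, subst sum.swap) (simp add: mult_ac)
  also have "\<dots> = mat_inner B (transpose_mat A * C)"
    using assms by (simp add: mat_inner_eq[of B m k] index_mult_mat_sum[of "transpose_mat A" m n C k] sum_distrib_left
        del: index_mult_mat)
  finally show ?thesis .
qed

lemma mat_inner_mult_right:
  assumes A: "A \<in> carrier_mat n m" and B: "B \<in> carrier_mat m k" and C: "C \<in> carrier_mat n k"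
  shows "mat_inner (A * B) C = mat_inner A (C * transpose_mat B)"
proof -
  have "mat_inner (A * B) C = mat_inner (transpose_mat B * transpose_mat A) (transpose_mat C)"
    using assms by (metis mat_inner_transpose mult_carrier_mat transpose_mult)
  also have "\<dots> = mat_inner (transpose_mat A) (B * transpose_mat C)"
    using assms by (subst mat_inner_mult_left[of _ k m _ n]) auto
  also have "\<dots> = mat_inner A (C * transpose_mat B)"
    using mat_inner_transpose[of A n m "C * transpose_mat B"] assms
    by (simp add: transpose_mult[of C n k "transpose_mat B" m])
  finally show ?thesis .
qed

text \<open>Cauchy-Schwarz in each entry bounds its square by a row sum times a column sum, and the
  double sum of these products factors.\<close>

lemma frob_norm_mult:
  assumes A: "A \<in> carrier_mat n m" and B: "B \<in> carrier_mat m k"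
  shows "frob_norm (A * B) \<le> frob_norm A * frob_norm B"
proof -
  have "((A * B) $$ (i, j))\<^sup>2 \<le> (\<Sum>l<m. (A $$ (i, l))\<^sup>2) * (\<Sum>l<m. (B $$ (l, j))\<^sup>2)"
    if "i < n" "j < k" for i j
    unfolding index_mult_mat_sum[OF A B that] by (rule Cauchy_Schwarz_ineq_sum)
  then have "(frob_norm (A * B))\<^sup>2
      \<le> (\<Sum>i<n. \<Sum>j<k. (\<Sum>l<m. (A $$ (i, l))\<^sup>2) * (\<Sum>l<m. (B $$ (l, j))\<^sup>2))"
    using A B by (subst frob_norm_sq_eq[of _ n k]) (auto intro!: sum_mono simp del: index_mult_mat)
  also have "\<dots> = (\<Sum>i<n. \<Sum>l<m. (A $$ (i, l))\<^sup>2) * (\<Sum>j<k. \<Sum>l<m. (B $$ (l, j))\<^sup>2)"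
    by (simp add: sum_product)
  also have "(\<Sum>j<k. \<Sum>l<m. (B $$ (l, j))\<^sup>2) = (frob_norm B)\<^sup>2"
    using B by (subst sum.swap) (simp add: frob_norm_sq_eq)
  finally have "(frob_norm (A * B))\<^sup>2 \<le> (frob_norm A * frob_norm B)\<^sup>2"
    using A by (simp add: frob_norm_sq_eq[of A n m] power_mult_distrib)
  then show ?thesis by (rule power2_le_imp_le) simp
qed

lemma frob_norm_isometry:
  assumes Q: "Q \<in> carrier_mat n m" "transpose_mat Q * Q = 1\<^sub>m m" and A: "A \<in> carrier_mat m k"
  shows "frob_norm (Q * A) = frob_norm A"
proof -
  have "mat_inner (Q * A) (Q * A) = mat_inner A (transpose_mat Q * (Q * A))"
    using assms by (subst mat_inner_mult_left[of _ n m _ k]) auto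
  also have "transpose_mat Q * (Q * A) = A"
    using assms by (subst assoc_mult_mat[symmetric, of _ m n _ m _ k]) auto
  finally show ?thesis by (metis frob_norm_nonneg frob_norm_sq power2_eq_imp_eq)
qed

lemma frob_norm_isometry_right:
  assumes Q: "Q \<in> carrier_mat n m" "transpose_mat Q * Q = 1\<^sub>m m" and A: "A \<in> carrier_mat k m"
  shows "frob_norm (A * transpose_mat Q) = frob_norm A"
proof -
  have "frob_norm (A * transpose_mat Q) = frob_norm (Q * transpose_mat A)"
    using assms by (subst frob_norm_transpose[symmetric], subst transpose_mult[of _ k m _ n]) auto
  then show ?thesis
    using frob_norm_isometry[OF Q, of "transpose_mat A" k] A by simp
qed

text \<open>Injectivity is tested on \<open>n\<close> by \<open>1\<close> matrices instead of
  vectors, so that a lower bound on Frobenius norms of products can supply it directly.\<close>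

lemma mat_right_inverse_exists:
  fixes T :: "real mat"
  assumes T: "T \<in> carrier_mat n n"
    and inj: "\<And>N. N \<in> carrier_mat n 1 \<Longrightarrow> T * N = 0\<^sub>m n 1 \<Longrightarrow> N = 0\<^sub>m n 1"
  shows "\<exists>S\<in>carrier_mat n n. T * S = 1\<^sub>m n"
proof -
  have "det T \<noteq> 0"
  proof
    assume "det T = 0"
    then obtain v where v: "v \<in> carrier_vec n" "v \<noteq> 0\<^sub>v n" "T *\<^sub>v v = 0\<^sub>v n"
      using det_0_iff_vec_prod_zero_field[OF T] by auto
    define N where "N = mat_of_cols n [v]"
    have N: "N \<in> carrier_mat n 1" using mat_of_cols_carrier(1)[of n "[v]"] by (simp add: N_def)
    have cN: "col N 0 = v" using v by (simp add: N_def)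
    have "T * N = 0\<^sub>m n 1"
    proof (rule eq_matI)
      fix i j assume "i < dim_row (0\<^sub>m n 1 :: real mat)" "j < dim_col (0\<^sub>m n 1 :: real mat)"
      then have ij: "i < n" "j = 0" by auto
      have "(T * N) $$ (i, 0) = (T *\<^sub>v v) $ i"
        using T N ij cN by simp
      then show "(T * N) $$ (i, j) = 0\<^sub>m n 1 $$ (i, j)" using ij v by simp
    qed (use T N in auto)
    then have "N = 0\<^sub>m n 1" by (rule inj[OF N])
    then have "v = 0\<^sub>v n" using cN by (auto simp: col_def)
    with v show False by simp
  qed
  then obtain S where "S \<in> carrier_mat n n" "T * S = 1\<^sub>m n"
    using det_non_zero_imp_unit[OF T, of "()"]
    by (auto simp: Units_def ring_mat_def)
  then show ?thesis by blast
qed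

section \<open>Maximizing over block diagonal orthogonal matrices\<close>

text \<open>Bolzano-Weierstrass, one coordinate at a time: a monotone subsequence converges in the
  new coordinate and keeps the limits already found. It supplies the compactness behind the
  existence of a maximizer.\<close>

lemma bounded_finite_coordinates_subseq:
  fixes f :: "nat \<Rightarrow> 'i \<Rightarrow> real"
  assumes "finite I" "\<And>n i. i \<in> I \<Longrightarrow> \<bar>f n i\<bar> \<le> b"
  shows "\<exists>\<phi> l. strict_mono (\<phi> :: nat \<Rightarrow> nat) \<and> (\<forall>i\<in>I. (\<lambda>n. f (\<phi> n) i) \<longlonglongrightarrow> l i)"
  using assms
proof (induction I rule: finite_induct)
  case empty
  show ?case by (intro exI[of _ id]) (simp add: strict_mono_def)
next
  case (insert x I)
  then obtain \<phi> l where \<phi>: "strict_mono (\<phi> :: nat \<Rightarrow> nat)" "\<forall>i\<in>I. (\<lambda>n. f (\<phi> n) i) \<longlonglongrightarrow> l i"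
    by auto
  obtain \<psi> where \<psi>: "strict_mono \<psi>" "monoseq (\<lambda>n. f (\<phi> (\<psi> n)) x)"
    using seq_monosub[of "\<lambda>n. f (\<phi> n) x"] by auto
  have "Bseq (\<lambda>n. f (\<phi> (\<psi> n)) x)"
    using insert.prems by (intro BseqI'[of _ b]) auto
  then obtain m where m: "(\<lambda>n. f (\<phi> (\<psi> n)) x) \<longlonglongrightarrow> m"
    using Bseq_monoseq_convergent[OF _ \<psi>(2)] by (auto simp: convergent_def)
  have "(\<lambda>n. f ((\<phi> \<circ> \<psi>) n) i) \<longlonglongrightarrow> (l(x := m)) i" if "i \<in> insert x I" for i
  proof (cases "i = x")
    case False
    with that \<phi>(2) have "(\<lambda>n. f (\<phi> n) i) \<longlonglongrightarrow> l i" by auto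
    from LIMSEQ_subseq_LIMSEQ[OF this \<psi>(1)] show ?thesis using False by (simp add: comp_def)
  qed (use m in simp)
  moreover have "strict_mono (\<phi> \<circ> \<psi>)" using \<phi>(1) \<psi>(1) by (rule strict_mono_o)
  ultimately show ?case by blast
qed

section \<open>Matrices supported on the level sets of \<open>c\<close>\<close>

text \<open>For \<open>n\<close> by \<open>n\<close> matrices this is exactly commuting with
  \<open>diag_mat_of n c\<close>. Encoding blocks by the level sets of \<open>c\<close> turns
  closure under products and transposes into entrywise checks.\<close>

definition block_supported :: "(nat \<Rightarrow> real) \<Rightarrow> nat \<Rightarrow> real mat \<Rightarrow> bool" where
  "block_supported c n U \<longleftrightarrow> (\<forall>i<n. \<forall>j<n. c i \<noteq> c j \<longrightarrow> U $$ (i, j) = 0)"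

text \<open>If \<open>c i\<close> and \<open>c j\<close> differ, every intermediate index
  \<open>l\<close> differs in level from \<open>i\<close> or from \<open>j\<close>, so each summand
  has a zero factor.\<close>

lemma block_supported_mult:
  assumes "A \<in> carrier_mat n n" "B \<in> carrier_mat n n"
    and "block_supported c n A" "block_supported c n B"
  shows "block_supported c n (A * B)"
  unfolding block_supported_def
proof (intro allI impI)
  fix i j assume ij: "i < n" "j < n" "c i \<noteq> c j"
  have "A $$ (i, l) * B $$ (l, j) = 0" if "l < n" for l
    using assms(3,4) ij that unfolding block_supported_def by (cases "c i = c l") auto
  then show "(A * B) $$ (i, j) = 0"
    unfolding index_mult_mat_sum[OF assms(1,2) ij(1,2)] by (intro sum.neutral) simp
qed

lemma block_supported_transpose:
  "A \<in> carrier_mat n n \<Longrightarrow> block_supported c n A \<Longrightarrow> block_supported c n (transpose_mat A)"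
  by (auto simp: block_supported_def)

lemma block_supported_diff:
  "A \<in> carrier_mat n n \<Longrightarrow> B \<in> carrier_mat n n \<Longrightarrow>
    block_supported c n A \<Longrightarrow> block_supported c n B \<Longrightarrow> block_supported c n (A - B)"
  by (auto simp: block_supported_def)

lemma diag_mat_of_carrier [simp]: "diag_mat_of n q \<in> carrier_mat n n"
  by (simp add: diag_mat_of_def)

lemma diag_mat_of_dim [simp]: "dim_row (diag_mat_of n q) = n" "dim_col (diag_mat_of n q) = n"
  by (simp_all add: diag_mat_of_def)

lemma diag_mat_of_index [simp]:
  "i < n \<Longrightarrow> j < n \<Longrightarrow> diag_mat_of n q $$ (i, j) = (if i = j then q i else 0)"
  by (simp add: diag_mat_of_def)

lemma transpose_diag_mat_of [simp]: "transpose_mat (diag_mat_of n q) = diag_mat_of n q"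
  by (intro eq_matI) (auto simp: diag_mat_of_def)

lemma block_supported_diag: "block_supported c n (diag_mat_of n q)"
  by (auto simp: block_supported_def)

lemma mult_diag_mat_of_index:
  assumes "A \<in> carrier_mat n m" "i < n" "j < m"
  shows "(A * diag_mat_of m q) $$ (i, j) = A $$ (i, j) * q j"
proof -
  have "(A * diag_mat_of m q) $$ (i, j) = (\<Sum>l<m. if l = j then A $$ (i, j) * q j else 0)"
    unfolding index_mult_mat_sum[OF assms(1) diag_mat_of_carrier assms(2,3)]
    using assms by (intro sum.cong) auto
  then show ?thesis using assms by simp
qed

lemma diag_mat_of_mult_index:
  assumes "A \<in> carrier_mat n m" "i < n" "j < m"
  shows "(diag_mat_of n q * A) $$ (i, j) = q i * A $$ (i, j)"
proof -
  have "(diag_mat_of n q * A) $$ (i, j) = (\<Sum>l<n. if l = i then q i * A $$ (i, j) else 0)"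
    unfolding index_mult_mat_sum[OF diag_mat_of_carrier assms]
    using assms by (intro sum.cong) auto
  then show ?thesis using assms by simp
qed

lemma conj_diag_index:
  assumes U: "U \<in> carrier_mat n n" and ij: "i < n" "j < n"
  shows "(U * diag_mat_of n q * transpose_mat U) $$ (i, j)
    = (\<Sum>k<n. q k * (U $$ (i, k) * U $$ (j, k)))"
proof -
  have "U * diag_mat_of n q \<in> carrier_mat n n" using U by simp
  from index_mult_mat_sum[OF this, of "transpose_mat U" n i j] U ij
  show ?thesis by (simp add: mult_diag_mat_of_index[OF U] mult_ac del: index_mult_mat)
qed

text \<open>Orthogonality as polynomial equations in the entries: this form passes to entrywise
  limits and lets columns be rotated in pairs.\<close>

lemma orthogonal_columns:
  "orthogonal_mat n U \<longleftrightarrow> U \<in> carrier_mat n n \<and>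
    (\<forall>k<n. \<forall>l<n. (\<Sum>a<n. U $$ (a, k) * U $$ (a, l)) = (if k = l then 1 else 0))"
proof (cases "U \<in> carrier_mat n n")
  case True
  have "(transpose_mat U * U) $$ (k, l) = (\<Sum>a<n. U $$ (a, k) * U $$ (a, l))" if "k < n" "l < n" for k l
    using index_mult_mat_sum[of "transpose_mat U" n n U n k l] True that by simp
  moreover have "transpose_mat U * U = 1\<^sub>m n \<longleftrightarrow>
      (\<forall>k<n. \<forall>l<n. (transpose_mat U * U) $$ (k, l) = (if k = l then 1 else 0))"
    using True by (auto simp del: index_mult_mat(1) intro!: eq_matI)
  ultimately show ?thesis using True by (simp add: orthogonal_mat_def)
qed (simp add: orthogonal_mat_def)

lemma orthogonal_mat_transpose:
  assumes "orthogonal_mat n U"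
  shows "U * transpose_mat U = 1\<^sub>m n"
  using assms mat_mult_left_right_inverse[of "transpose_mat U" n U]
  by (auto simp: orthogonal_mat_def)

section \<open>Maximizing a linear functional over the orbit of
  \<open>diag_mat_of n q\<close>\<close>

text \<open>The bilinear form \<open>f^T H g\<close>, with vectors given as functions so that
  columns of a matrix can be inserted directly.\<close>

definition quad_form :: "nat \<Rightarrow> real mat \<Rightarrow> (nat \<Rightarrow> real) \<Rightarrow> (nat \<Rightarrow> real) \<Rightarrow> real" where
  "quad_form n H f g = (\<Sum>i<n. \<Sum>j<n. H $$ (i, j) * (f i * g j))"

text \<open>The pairing depends on \<open>U\<close> only through the values of the form of
  \<open>H\<close> at single columns, weighted by \<open>q\<close>; rotating two columns therefore
  changes just two summands.\<close>

lemma mat_inner_conj_diag: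
  assumes H: "H \<in> carrier_mat n n" and U: "U \<in> carrier_mat n n"
  shows "mat_inner H (U * diag_mat_of n q * transpose_mat U)
    = (\<Sum>k<n. q k * quad_form n H (\<lambda>a. U $$ (a, k)) (\<lambda>a. U $$ (a, k)))"
proof -
  have "mat_inner H (U * diag_mat_of n q * transpose_mat U)
      = (\<Sum>i<n. \<Sum>j<n. \<Sum>k<n. q k * (H $$ (i, j) * (U $$ (i, k) * U $$ (j, k))))"
    unfolding mat_inner_eq[OF H]
    by (intro sum.cong refl) (simp add: conj_diag_index[OF U] sum_distrib_left mult_ac del: index_mult_mat)
  also have "\<dots> = (\<Sum>k<n. \<Sum>i<n. \<Sum>j<n. q k * (H $$ (i, j) * (U $$ (i, k) * U $$ (j, k))))"
    by (subst (2) sum.swap, subst sum.swap) simp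
  finally show ?thesis by (simp add: quad_form_def sum_distrib_left)
qed

lemma quad_form_rotate:
  assumes H: "H \<in> carrier_mat n n" "transpose_mat H = H"
  shows "quad_form n H (\<lambda>a. x * f a + y * g a) (\<lambda>a. x * f a + y * g a)
    = x\<^sup>2 * quad_form n H f f + 2 * x * y * quad_form n H f g + y\<^sup>2 * quad_form n H g g"
proof -
  have sym: "H $$ (i, j) = H $$ (j, i)" if "i < n" "j < n" for i j
    using H that by (metis carrier_matD index_transpose_mat(1))
  have gf: "quad_form n H g f = quad_form n H f g"
    unfolding quad_form_def by (subst sum.swap) (auto intro!: sum.cong simp: sym)
  have "quad_form n H (\<lambda>a. x * f a + y * g a) (\<lambda>a. x * f a + y * g a)
    = x\<^sup>2 * quad_form n H f f + x * y * quad_form n H f g + x * y * quad_form n H g f + y\<^sup>2 * quad_form n H g g"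
  proof -
    have "H $$ (i, j) * ((x * f i + y * g i) * (x * f j + y * g j))
      = x\<^sup>2 * (H $$ (i, j) * (f i * f j)) + x * y * (H $$ (i, j) * (f i * g j))
        + x * y * (H $$ (i, j) * (g i * f j)) + y\<^sup>2 * (H $$ (i, j) * (g i * g j))" for i j
      by (simp add: algebra_simps power2_eq_square)
    then show ?thesis by (simp only: quad_form_def sum.distrib sum_distrib_left)
  qed
  then show ?thesis by (simp add: gf)
qed

lemma orthogonal_entry_bound:
  assumes "orthogonal_mat n U" "i < n" "k < n"
  shows "\<bar>U $$ (i, k)\<bar> \<le> 1"
proof -
  have "(U $$ (i, k))\<^sup>2 \<le> (\<Sum>a<n. (U $$ (a, k))\<^sup>2)"
    using assms by (intro member_le_sum) auto
  also have "\<dots> = 1" using assms by (auto simp: orthogonal_columns power2_eq_square)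
  finally show ?thesis by (simp add: abs_square_le_1)
qed

text \<open>The block orthogonal matrices form a compact set and the pairing is a polynomial in the
  entries, so a maximizing sequence has a subsequence converging to a maximizer.\<close>

lemma ex_max_conj_diag:
  assumes H: "H \<in> carrier_mat n n"
  shows "\<exists>U. orthogonal_mat n U \<and> block_supported c n U \<and>
    (\<forall>U'. orthogonal_mat n U' \<longrightarrow> block_supported c n U' \<longrightarrow>
      mat_inner H (U' * diag_mat_of n q * transpose_mat U')
        \<le> mat_inner H (U * diag_mat_of n q * transpose_mat U))"
proof -
  define S where "S = {U. orthogonal_mat n U \<and> block_supported c n U}"
  define F where "F U = (\<Sum>k<n. q k * (\<Sum>i<n. \<Sum>j<n. H $$ (i, j) * (U $$ (i, k) * U $$ (j, k))))" for U :: "real mat"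
  have F: "mat_inner H (U * diag_mat_of n q * transpose_mat U) = F U" if "U \<in> S" for U
    using that mat_inner_conj_diag[OF H, of U q] by (simp add: S_def F_def quad_form_def orthogonal_mat_def)
  have "1\<^sub>m n \<in> S" by (auto simp: S_def orthogonal_mat_def block_supported_def)
  then have ne: "S \<noteq> {}" by auto
  \<comment> \<open>Entries of an orthogonal matrix are at most 1 in absolute value, so taking
    absolute values everywhere and replacing the entries of \<open>U\<close> by 1 bounds
    \<open>F\<close> from above.\<close>
  define b where "b = (\<Sum>k<n. \<bar>q k\<bar> * (\<Sum>i<n. \<Sum>j<n. \<bar>H $$ (i, j)\<bar>))"
  have Fb: "F U \<le> b" if "U \<in> S" for U
  proof -
    have "\<bar>U $$ (i, k) * U $$ (j, k)\<bar> \<le> 1" if "i < n" "j < n" "k < n" for i j k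
      using that \<open>U \<in> S\<close> orthogonal_entry_bound[of n U] by (auto simp: S_def abs_mult intro!: mult_le_one)
    then have "\<bar>H $$ (i, j) * (U $$ (i, k) * U $$ (j, k))\<bar> \<le> \<bar>H $$ (i, j)\<bar>" if "i < n" "j < n" "k < n" for i j k
      using that by (metis abs_ge_zero abs_mult mult_left_le)
    then have "\<bar>\<Sum>i<n. \<Sum>j<n. H $$ (i, j) * (U $$ (i, k) * U $$ (j, k))\<bar> \<le> (\<Sum>i<n. \<Sum>j<n. \<bar>H $$ (i, j)\<bar>)" if "k < n" for k
      using that by (intro order_trans[OF sum_abs] sum_mono order_trans[OF sum_abs]) auto
    then have "q k * (\<Sum>i<n. \<Sum>j<n. H $$ (i, j) * (U $$ (i, k) * U $$ (j, k)))
        \<le> \<bar>q k\<bar> * (\<Sum>i<n. \<Sum>j<n. \<bar>H $$ (i, j)\<bar>)" if "k < n" for k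
      using that by - (rule order_trans[OF abs_ge_self], simp add: abs_mult mult_left_mono)
    then show ?thesis unfolding F_def b_def by (intro sum_mono) simp
  qed
  then have bdd: "bdd_above (F ` S)" by (auto intro!: bdd_aboveI2)
  \<comment> \<open>A maximizing sequence: \<open>u m\<close> comes within \<open>1 / Suc m\<close>
    of the supremum.\<close>
  have "\<exists>U\<in>S. Sup (F ` S) - 1 / Suc m < F U" for m
    using less_cSup_iff[of "F ` S" "Sup (F ` S) - 1 / Suc m"] ne bdd by auto
  then obtain u where u: "\<And>m. u m \<in> S" "\<And>m. Sup (F ` S) - 1 / Suc m < F (u m)" by metis
  have "\<bar>u m $$ x\<bar> \<le> 1" if "x \<in> {..<n} \<times> {..<n}" for m x
    using u(1)[of m] that orthogonal_entry_bound[of n "u m"] by (auto simp: S_def)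
  from bounded_finite_coordinates_subseq[of "{..<n} \<times> {..<n}" "\<lambda>m x. u m $$ x", OF _ this]
  obtain \<phi> l where \<phi>: "strict_mono (\<phi> :: nat \<Rightarrow> nat)"
    and l: "\<And>i j. i < n \<Longrightarrow> j < n \<Longrightarrow> (\<lambda>m. u (\<phi> m) $$ (i, j)) \<longlonglongrightarrow> l (i, j)" by auto
  define U where "U = mat n n l"
  have lU: "(\<lambda>m. u (\<phi> m) $$ (i, j)) \<longlonglongrightarrow> U $$ (i, j)" if "i < n" "j < n" for i j
    using l that by (simp add: U_def)
  \<comment> \<open>Each constraint is a polynomial equation in the entries, hence survives the
    limit.\<close>
  have "U \<in> S"
    unfolding S_def mem_Collect_eq orthogonal_columns block_supported_def
  proof (intro conjI allI impI)
    fix i j assume ij: "i < n" "j < n"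
    have "(\<lambda>m. \<Sum>a<n. u (\<phi> m) $$ (a, i) * u (\<phi> m) $$ (a, j)) \<longlonglongrightarrow> (\<Sum>a<n. U $$ (a, i) * U $$ (a, j))"
      using ij by (intro tendsto_sum tendsto_mult lU) auto
    moreover have "(\<Sum>a<n. u (\<phi> m) $$ (a, i) * u (\<phi> m) $$ (a, j)) = (if i = j then 1 else 0)" for m
      using u(1)[of "\<phi> m"] ij by (simp add: S_def orthogonal_columns)
    ultimately have "(\<lambda>m. if i = j then 1 else 0) \<longlonglongrightarrow> (\<Sum>a<n. U $$ (a, i) * U $$ (a, j))" by simp
    from LIMSEQ_unique[OF this tendsto_const]
    show "(\<Sum>a<n. U $$ (a, i) * U $$ (a, j)) = (if i = j then 1 else 0)" .
  next
    fix i j assume ij: "i < n" "j < n" "c i \<noteq> c j"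
    then have "u (\<phi> m) $$ (i, j) = 0" for m
      using u(1)[of "\<phi> m"] by (simp add: S_def block_supported_def)
    with lU[OF ij(1,2)] show "U $$ (i, j) = 0" by (simp add: LIMSEQ_const_iff)
  qed (simp add: U_def)
  have "(\<lambda>m. F (u (\<phi> m))) \<longlonglongrightarrow> F U"
    unfolding F_def by (intro tendsto_sum tendsto_mult tendsto_const lU) auto
  moreover have "(\<lambda>m. Sup (F ` S) - 1 / Suc (\<phi> m)) \<longlonglongrightarrow> Sup (F ` S) - 0"
    using LIMSEQ_subseq_LIMSEQ[OF LIMSEQ_Suc[OF lim_1_over_n] \<phi>]
    by (intro tendsto_diff tendsto_const) (simp add: comp_def)
  ultimately have "Sup (F ` S) \<le> F U"
    using LIMSEQ_le[of "\<lambda>m. Sup (F ` S) - 1 / Suc (\<phi> m)" "Sup (F ` S) - 0" "\<lambda>m. F (u (\<phi> m))" "F U"]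
      less_imp_le[OF u(2)] by simp
  then have "\<forall>U'\<in>S. F U' \<le> F U" using bdd by (meson cSUP_upper order_trans)
  then have "\<forall>U'\<in>S. mat_inner H (U' * diag_mat_of n q * transpose_mat U')
        \<le> mat_inner H (U * diag_mat_of n q * transpose_mat U)"
    using F \<open>U \<in> S\<close> by simp
  with \<open>U \<in> S\<close> show ?thesis by (auto simp: S_def)
qed

section \<open>First-order conditions at a maximizer\<close>

text \<open>Near \<open>t = 0\<close> a linear term wins over a quadratic one. The test value
  \<open>Q / (|D| + 1)\<close> already shows this, since it makes the left side at least twice the
  right side.\<close>

lemma no_first_order_increase:
  fixes D Q :: real
  assumes "\<And>t. 2 * t * Q \<le> D * t\<^sup>2"
  shows "Q = 0"
proof -
  define t where "t = Q / (\<bar>D\<bar> + 1)"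
  have Q: "Q = t * (\<bar>D\<bar> + 1)" by (simp add: t_def)
  have "2 * (\<bar>D\<bar> + 1) * t\<^sup>2 \<le> D * t\<^sup>2"
    using assms[of t] unfolding Q by (simp add: power2_eq_square algebra_simps)
  also have "\<dots> \<le> (\<bar>D\<bar> + 1) * t\<^sup>2" by (intro mult_right_mono) auto
  finally have "(\<bar>D\<bar> + 1) * t\<^sup>2 \<le> 0" by (simp only: mult.assoc)
  then have "t\<^sup>2 \<le> 0" using abs_ge_zero[of D] by (simp only: mult_le_0_iff) linarith
  then show ?thesis unfolding Q by simp
qed

text \<open>Rotating columns \<open>i\<close> and \<open>j\<close> of the maximizer against each
  other stays admissible because both lie on the same level of \<open>c\<close>. The first-order
  change of the pairing is \<open>2 t (q i - q j)\<close> times the \<open>(i, j)\<close> entry of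
  \<open>U^T H U\<close>, and it cannot be positive for either sign of \<open>t\<close>.\<close>

lemma max_conj_diag_orthogonality:
  assumes H: "H \<in> carrier_mat n n" "transpose_mat H = H"
    and U: "orthogonal_mat n U" "block_supported c n U"
    and max: "\<And>U'. orthogonal_mat n U' \<Longrightarrow> block_supported c n U' \<Longrightarrow>
      mat_inner H (U' * diag_mat_of n q * transpose_mat U')
        \<le> mat_inner H (U * diag_mat_of n q * transpose_mat U)"
    and ij: "i < n" "j < n" "c i = c j" "q i \<noteq> q j"
  shows "quad_form n H (\<lambda>a. U $$ (a, i)) (\<lambda>a. U $$ (a, j)) = 0"
proof -
  define f where "f k = (\<lambda>a. U $$ (a, k))" for k
  define Q where "Q k l = quad_form n H (f k) (f l)" for k l
  have UC: "U \<in> carrier_mat n n" using U by (simp add: orthogonal_mat_def)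
  have "i \<noteq> j" using ij by auto
  have key: "2 * t * ((q i - q j) * Q i j) \<le> ((q i - q j) * (Q i i - Q j j)) * t\<^sup>2" for t
  proof -
    \<comment> \<open>\<open>x\<close> and \<open>y\<close> are the cosine and sine of the angle
      with tangent \<open>t\<close>, so the trigonometry reduces to
      \<open>x^2 (1 + t^2) = 1\<close>.\<close>
    define x where "x = 1 / sqrt (1 + t\<^sup>2)"
    define y where "y = t * x"
    have "0 < 1 + t\<^sup>2" by (simp add: add_pos_nonneg)
    then have x0: "0 < x" and x2: "x\<^sup>2 * (1 + t\<^sup>2) = 1" by (simp_all add: x_def power_divide)
    have xy: "x * x + y * y = 1"
      using x2 by (simp add: y_def power2_eq_square algebra_simps)
    define U' where "U' = mat n n (\<lambda>(a, k). if k = i then x * U $$ (a, i) + y * U $$ (a, j)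
        else if k = j then (- y) * U $$ (a, i) + x * U $$ (a, j) else U $$ (a, k))"
    have U'C: "U' \<in> carrier_mat n n" by (simp add: U'_def)
    have orth: "(\<Sum>a<n. U $$ (a, k) * U $$ (a, l)) = (if k = l then 1 else 0)" if "k < n" "l < n" for k l
      using U(1) that by (simp add: orthogonal_columns)
    have lin: "(\<Sum>a<n. (\<alpha> * U $$ (a, k) + \<beta> * U $$ (a, l)) * (\<gamma> * U $$ (a, k') + \<delta> * U $$ (a, l')))
      = \<alpha> * \<gamma> * (\<Sum>a<n. U $$ (a, k) * U $$ (a, k')) + \<alpha> * \<delta> * (\<Sum>a<n. U $$ (a, k) * U $$ (a, l'))
      + \<beta> * \<gamma> * (\<Sum>a<n. U $$ (a, l) * U $$ (a, k')) + \<beta> * \<delta> * (\<Sum>a<n. U $$ (a, l) * U $$ (a, l'))"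
      for \<alpha> \<beta> \<gamma> \<delta> k l k' l'
    proof -
      have "(\<alpha> * U $$ (a, k) + \<beta> * U $$ (a, l)) * (\<gamma> * U $$ (a, k') + \<delta> * U $$ (a, l'))
        = \<alpha> * \<gamma> * (U $$ (a, k) * U $$ (a, k')) + \<alpha> * \<delta> * (U $$ (a, k) * U $$ (a, l'))
        + \<beta> * \<gamma> * (U $$ (a, l) * U $$ (a, k')) + \<beta> * \<delta> * (U $$ (a, l) * U $$ (a, l'))" for a
        by (simp add: algebra_simps)
      then show ?thesis by (simp only: sum.distrib sum_distrib_left)
    qed
    have "orthogonal_mat n U'"
      unfolding orthogonal_columns
    proof (intro conjI allI impI U'C)
      fix k l assume kl: "k < n" "l < n"
      \<comment> \<open>Every column \<open>k\<close> of \<open>U'\<close> is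
        \<open>\<alpha> k\<close> times column \<open>g k\<close> plus \<open>\<beta> k\<close>
        times column \<open>j\<close> of \<open>U\<close>, so the one bilinear expansion
        \<open>lin\<close> covers all cases of \<open>k\<close> and \<open>l\<close>.\<close>
      define \<alpha> where "\<alpha> k = (if k = i then x else if k = j then - y else 1)" for k
      define \<beta> where "\<beta> k = (if k = i then y else if k = j then x else 0)" for k
      define g where "g k = (if k = i \<or> k = j then i else k)" for k
      have col: "U' $$ (a, k) = \<alpha> k * U $$ (a, g k) + \<beta> k * U $$ (a, j)" if "a < n" "k < n" for a k
        using that \<open>i \<noteq> j\<close> by (simp add: U'_def \<alpha>_def \<beta>_def g_def)
      have gn: "g k < n" "g l < n" using kl ij by (auto simp: g_def)
      have "(\<Sum>a<n. U' $$ (a, k) * U' $$ (a, l))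
        = (\<Sum>a<n. (\<alpha> k * U $$ (a, g k) + \<beta> k * U $$ (a, j)) * (\<alpha> l * U $$ (a, g l) + \<beta> l * U $$ (a, j)))"
        using kl by (intro sum.cong) (auto simp: col)
      also have "\<dots> = \<alpha> k * \<alpha> l * (if g k = g l then 1 else 0) + \<alpha> k * \<beta> l * (if g k = j then 1 else 0)
         + \<beta> k * \<alpha> l * (if j = g l then 1 else 0) + \<beta> k * \<beta> l"
        unfolding lin using gn ij by (simp add: orth)
      also have "\<dots> = (if k = l then 1 else 0)"
        using \<open>i \<noteq> j\<close> \<open>i \<noteq> j\<close>[symmetric] xy unfolding \<alpha>_def \<beta>_def g_def
        by (cases "k = i"; cases "k = j"; cases "l = i"; cases "l = j"; simp add: add.commute)
      finally show "(\<Sum>a<n. U' $$ (a, k) * U' $$ (a, l)) = (if k = l then 1 else 0)" .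
    qed
    \<comment> \<open>Columns \<open>i\<close> and \<open>j\<close> have their forced zeros in the
      same rows, as \<open>c i = c j\<close>.\<close>
    moreover have "block_supported c n U'"
      using U(2) ij by (auto simp: block_supported_def U'_def)
    ultimately have le: "mat_inner H (U' * diag_mat_of n q * transpose_mat U')
        \<le> mat_inner H (U * diag_mat_of n q * transpose_mat U)" by (rule max)
    define Q' where "Q' k = quad_form n H (\<lambda>a. U' $$ (a, k)) (\<lambda>a. U' $$ (a, k))" for k
    have Q'i: "Q' i = x\<^sup>2 * Q i i + 2 * x * y * Q i j + y\<^sup>2 * Q j j"
    proof -
      have "Q' i = quad_form n H (\<lambda>a. x * f i a + y * f j a) (\<lambda>a. x * f i a + y * f j a)"
        using ij by (simp add: Q'_def quad_form_def U'_def f_def)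
      then show ?thesis by (simp add: quad_form_rotate[OF H] Q_def)
    qed
    have Q'j: "Q' j = y\<^sup>2 * Q i i - 2 * x * y * Q i j + x\<^sup>2 * Q j j"
    proof -
      have "Q' j = quad_form n H (\<lambda>a. (- y) * f i a + x * f j a) (\<lambda>a. (- y) * f i a + x * f j a)"
        using ij \<open>i \<noteq> j\<close> by (simp add: Q'_def quad_form_def U'_def f_def)
      then show ?thesis unfolding quad_form_rotate[OF H] Q_def by simp
    qed
    have Q'k: "Q' k = Q k k" if "k < n" "k \<noteq> i" "k \<noteq> j" for k
      using that by (simp add: Q'_def Q_def quad_form_def U'_def f_def)
    have "(\<Sum>k<n. q k * Q' k - q k * Q k k) = (\<Sum>k\<in>{i, j}. q k * Q' k - q k * Q k k)"
      using ij Q'k by (intro sum.mono_neutral_right) auto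
    moreover have "(\<Sum>k<n. q k * Q' k - q k * Q k k) \<le> 0"
      using le unfolding mat_inner_conj_diag[OF H(1) UC] mat_inner_conj_diag[OF H(1) U'C]
      by (simp add: sum_subtractf Q'_def Q_def f_def)
    ultimately have "q i * (Q' i - Q i i) + q j * (Q' j - Q j j) \<le> 0"
      using \<open>i \<noteq> j\<close> by (simp add: algebra_simps)
    moreover have "q i * (Q' i - Q i i) + q j * (Q' j - Q j j)
      = x\<^sup>2 * ((q i - q j) * (2 * t * Q i j - t\<^sup>2 * (Q i i - Q j j)))"
    proof -
      \<comment> \<open>Multiplying by \<open>x^2 (1 + t^2) = 1\<close> gives the old values the
        prefactor \<open>x^2\<close> of the new ones, and the changes of the two summands turn out
        to be opposite.\<close>
      have "Q i i = x\<^sup>2 * (1 + t\<^sup>2) * Q i i" "Q j j = x\<^sup>2 * (1 + t\<^sup>2) * Q j j" using x2 by simp_all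
      then have *: "Q' i - Q i i = x\<^sup>2 * (2 * t * Q i j - t\<^sup>2 * (Q i i - Q j j))"
        "Q' j - Q j j = - (x\<^sup>2 * (2 * t * Q i j - t\<^sup>2 * (Q i i - Q j j)))"
        unfolding Q'i Q'j y_def by (simp_all add: power2_eq_square algebra_simps)
      show ?thesis unfolding * by (simp add: algebra_simps)
    qed
    ultimately have "(q i - q j) * (2 * t * Q i j - t\<^sup>2 * (Q i i - Q j j)) \<le> 0"
      using x0 by (simp add: mult_le_0_iff not_le zero_less_mult_iff)
    then show ?thesis by (simp add: algebra_simps)
  qed
  have "(q i - q j) * Q i j = 0"
    by (rule no_first_order_increase[of _ "(q i - q j) * (Q i i - Q j j)"]) (rule key)
  then show ?thesis using ij(4) by (simp add: Q_def f_def)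
qed

section \<open>Perturbation of stationary points\<close>

text \<open>In the basis of the columns of \<open>U\<close>, the matrix \<open>H\<close> becomes
  \<open>K = U^T H U\<close>, and commuting with \<open>diag_mat_of n q\<close> means that
  \<open>K\<close> vanishes wherever \<open>q i\<close> and \<open>q j\<close> differ. Stationarity
  gives this inside a block, block support outside.\<close>

lemma max_conj_diag_commute:
  assumes H: "H \<in> carrier_mat n n" "transpose_mat H = H" "block_supported c n H"
    and U: "orthogonal_mat n U" "block_supported c n U"
    and max: "\<And>U'. orthogonal_mat n U' \<Longrightarrow> block_supported c n U' \<Longrightarrow>
      mat_inner H (U' * diag_mat_of n q * transpose_mat U')
        \<le> mat_inner H (U * diag_mat_of n q * transpose_mat U)"
  shows "H * (U * diag_mat_of n q * transpose_mat U) = (U * diag_mat_of n q * transpose_mat U) * H"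
proof -
  let ?T = "transpose_mat U"
  define J where "J = diag_mat_of n q"
  have JC: "J \<in> carrier_mat n n" by (simp add: J_def)
  define K where "K = ?T * (H * U)"
  have UC: "U \<in> carrier_mat n n" and TC: "?T \<in> carrier_mat n n" and UU: "?T * U = 1\<^sub>m n"
    using U by (simp_all add: orthogonal_mat_def)
  have UU': "U * ?T = 1\<^sub>m n" using orthogonal_mat_transpose[OF U(1)] .
  have HU: "H * U \<in> carrier_mat n n" using H UC by simp
  have KC: "K \<in> carrier_mat n n" using HU TC by (simp add: K_def)
  have Kb: "block_supported c n K"
    unfolding K_def using H U UC HU TC
    by (intro block_supported_mult block_supported_transpose) auto
  have Kij: "K $$ (i, j) = quad_form n H (\<lambda>a. U $$ (a, i)) (\<lambda>a. U $$ (a, j))" if "i < n" "j < n" for i j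
    unfolding K_def index_mult_mat_sum[OF TC HU that] quad_form_def using that UC
    by (intro sum.cong refl)
      (simp add: index_mult_mat_sum[OF H(1) UC] sum_distrib_left mult_ac del: index_mult_mat)
  have KJ: "K * J = J * K"
  proof (rule eq_matI)
    fix i j assume "i < dim_row (J * K)" "j < dim_col (J * K)"
    then have ij: "i < n" "j < n" using KC JC by auto
    have "K $$ (i, j) * q j = q i * K $$ (i, j)"
    proof (cases "q i = q j")
      case False
      have "K $$ (i, j) = 0"
      proof (cases "c i = c j")
        case True
        show ?thesis
          unfolding Kij[OF ij] by (rule max_conj_diag_orthogonality[OF H(1,2) U max ij True False])
      qed (use Kb ij in \<open>simp add: block_supported_def\<close>)
      then show ?thesis by simp
    qed simp
    then show "(K * J) $$ (i, j) = (J * K) $$ (i, j)"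
      using ij by (simp add: J_def mult_diag_mat_of_index[OF KC] diag_mat_of_mult_index[OF KC] del: index_mult_mat)
  qed (use KC JC in auto)
  note assoc = assoc_mult_mat[of _ n n _ n _ n]
  have "(U * ?T) * (H * U) = U * K"
    unfolding K_def using H(1) UC TC by (simp add: assoc)
  then have UK: "H * U = U * K" by (simp only: UU' left_mult_one_mat[OF HU])
  have KT: "K * ?T = ?T * H"
    using H(1) UC TC UU' unfolding K_def by (simp add: assoc)
  have "H * (U * J * ?T) = (H * U) * J * ?T"
    using H(1) UC TC JC by (simp add: assoc)
  also have "\<dots> = U * (K * J) * ?T"
    unfolding UK using UC KC TC JC by (simp add: assoc)
  also have "\<dots> = U * J * (K * ?T)"
    unfolding KJ using UC KC TC JC by (simp add: assoc)
  also have "\<dots> = (U * J * ?T) * H"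
    unfolding KT using UC H(1) TC JC by (simp add: assoc)
  finally show ?thesis unfolding J_def .
qed

text \<open>\<open>M\<close> stacked over \<open>C\<close> has orthonormal columns, so multiplying
  by it preserves the norm, which splits over the two blocks.\<close>

lemma frob_norm_column_split:
  assumes "M \<in> carrier_mat n n" "C \<in> carrier_mat m n" "N \<in> carrier_mat n k"
    and "transpose_mat M * M + transpose_mat C * C = 1\<^sub>m n"
  shows "(frob_norm (M * N))\<^sup>2 + (frob_norm (C * N))\<^sup>2 = (frob_norm N)\<^sup>2"
proof -
  have "(frob_norm (M * N))\<^sup>2 + (frob_norm (C * N))\<^sup>2
      = mat_inner N (transpose_mat M * (M * N)) + mat_inner N (transpose_mat C * (C * N))"
    using assms by (simp add: frob_norm_sq mat_inner_mult_left[of _ n n _ k] mat_inner_mult_left[of _ m n _ k])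
  also have "\<dots> = mat_inner N ((transpose_mat M * M) * N + (transpose_mat C * C) * N)"
    using assms by (subst mat_inner_add_right[of _ n k])
      (auto simp: assoc_mult_mat[of _ n n _ n _ k] assoc_mult_mat[of _ n m _ n _ k])
  also have "(transpose_mat M * M) * N + (transpose_mat C * C) * N = N"
    using assms by (subst add_mult_distrib_mat[symmetric, of _ n n _ _ k]) auto
  finally show ?thesis by (simp add: frob_norm_sq)
qed

lemma frob_norm_contraction:
  assumes "M \<in> carrier_mat n n" "C \<in> carrier_mat m n" "N \<in> carrier_mat n k"
    and "transpose_mat M * M + transpose_mat C * C = 1\<^sub>m n"
  shows "frob_norm (C * N) \<le> frob_norm N"
proof (rule power2_le_imp_le)
  show "(frob_norm (C * N))\<^sup>2 \<le> (frob_norm N)\<^sup>2"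
    using frob_norm_column_split[OF assms] by (metis add_increasing order_refl zero_le_power2)
qed simp

text \<open>The identity \<open>M^T M + C^T C = I\<close> is paired with \<open>Y = W Z\<close>. The
  part \<open>W + Z\<close> contributes \<open><W, Z> + 2 |Z|^2\<close> plus a cubic term,
  \<open><I, Y>\<close> equals \<open><W, Z>\<close>, and the cross terms with \<open>G\<close>
  vanish by orthogonality. So \<open>2 |Z|^2\<close> is bounded by the cubic term and the terms in
  \<open>G\<close> and \<open>C\<close>, and \<open>|Z| < 1\<close> absorbs the cubic one.\<close>

lemma commuting_part_bound:
  assumes carrier: "W \<in> carrier_mat n n" "Z \<in> carrier_mat n n" "G \<in> carrier_mat n n" "C \<in> carrier_mat m n"
    and M: "M = W + Z + G" "transpose_mat M * M + transpose_mat C * C = 1\<^sub>m n"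
    and W: "transpose_mat W = W" "W * W = 1\<^sub>m n"
    and Z: "transpose_mat Z = Z" "W * Z = Z * W" "frob_norm Z < 1"
    and G: "mat_inner G Z = 0" "mat_inner G (Z * (W * Z)) = 0"
  shows "frob_norm Z \<le> frob_norm C + (frob_norm G)\<^sup>2"
proof -
  define P where "P = W + Z"
  define Y where "Y = W * Z"
  define T where "T = Z * Y"
  have c: "P \<in> carrier_mat n n" "Y \<in> carrier_mat n n" "T \<in> carrier_mat n n" "M \<in> carrier_mat n n"
    "G * Y \<in> carrier_mat n n" "C * Y \<in> carrier_mat m n" "M * Y \<in> carrier_mat n n"
    "P * Y \<in> carrier_mat n n"
    using carrier by (auto simp: P_def Y_def T_def M)
  note car = carrier c
  note assoc = assoc_mult_mat[of _ n n _ n _ n]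
  have Yt: "transpose_mat Y = Y"
    unfolding Y_def transpose_mult[OF carrier(1,2)] W(1) Z(1) by (rule Z(2)[symmetric])
  have WY: "W * Y = Z"
    unfolding Y_def by (simp only: assoc_mult_mat[OF carrier(1,1,2), symmetric] W(2) left_mult_one_mat[OF carrier(2)])
  have PY: "P * Y = Z + T"
    unfolding P_def using car by (subst add_mult_distrib_mat[of _ n n]) (auto simp: WY T_def)
  \<comment> \<open>In the form \<open>W Z^2\<close> the pairing of \<open>T\<close> with
    \<open>W\<close> becomes \<open>|Z|^2\<close>, the second copy of that term.\<close>
  have T: "T = W * (Z * Z)"
    unfolding T_def Y_def using carrier(1,2)
    by (simp only: assoc_mult_mat[OF carrier(2,1,2), symmetric] Z(2)[symmetric] assoc_mult_mat[OF carrier(1,2,2)])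
  have MPG: "M = P + G" by (simp add: M P_def)
  have MY: "M * Y = P * Y + G * Y"
    unfolding MPG using car by (subst add_mult_distrib_mat[of _ n n]) auto
  have GPY: "mat_inner G (P * Y) = 0"
    unfolding PY using car G by (simp add: mat_inner_add_right[of _ n n] T_def Y_def)
  \<comment> \<open>Moving the symmetric factor \<open>Y\<close> across the pairing reduces this
    cross term to the previous one.\<close>
  have PGY: "mat_inner P (G * Y) = 0"
    using car GPY by (subst mat_inner_commute[of _ n n]) (auto simp: mat_inner_mult_right[of _ n n _ n] Yt)
  have PPY: "mat_inner P (P * Y) = mat_inner W Z + 2 * (frob_norm Z)\<^sup>2 + mat_inner Z T"
  proof -
    have "mat_inner W T = mat_inner T W" using car by (intro mat_inner_commute) auto
    also have "\<dots> = mat_inner (Z * Z) (1\<^sub>m n)"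
      unfolding T using car by (subst mat_inner_mult_left[of _ n n _ n]) (auto simp: W)
    also have "\<dots> = mat_inner Z Z"
      using car by (subst mat_inner_mult_left[of _ n n _ n]) (auto simp: Z)
    finally show ?thesis
      unfolding PY using car unfolding P_def frob_norm_sq
      by (simp add: mat_inner_add_right[of _ n n] mat_inner_add_left[of _ n n])
  qed
  have "mat_inner (transpose_mat M * M) Y = mat_inner M (M * Y)"
    using car by (subst mat_inner_mult_left[of _ n n _ n]) auto
  also have "\<dots> = mat_inner P (P * Y) + mat_inner P (G * Y) + mat_inner G (P * Y) + mat_inner G (G * Y)"
    unfolding MY unfolding MPG using car
    by (simp add: mat_inner_add_right[of _ n n] mat_inner_add_left[of _ n n])
  also have "\<dots> = mat_inner W Z + 2 * (frob_norm Z)\<^sup>2 + mat_inner Z T + mat_inner G (G * Y)"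
    by (simp add: GPY PGY PPY)
  finally have 1: "mat_inner (transpose_mat M * M) Y
    = mat_inner W Z + 2 * (frob_norm Z)\<^sup>2 + mat_inner Z T + mat_inner G (G * Y)" .
  have 2: "mat_inner (transpose_mat C * C) Y = mat_inner C (C * Y)"
    using car by (subst mat_inner_mult_left[of _ n m _ n]) auto
  have "mat_inner (1\<^sub>m n) Y = mat_inner Y (1\<^sub>m n)" using car by (intro mat_inner_commute) auto
  also have "\<dots> = mat_inner Z W"
    unfolding Y_def using car by (subst mat_inner_mult_left[of _ n n _ n]) (auto simp: W)
  also have "\<dots> = mat_inner W Z" using car by (intro mat_inner_commute) auto
  finally have 3: "mat_inner (1\<^sub>m n) Y = mat_inner W Z" .
  have "mat_inner (transpose_mat M * M + transpose_mat C * C) Y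
      = mat_inner (transpose_mat M * M) Y + mat_inner (transpose_mat C * C) Y"
    using car by (intro mat_inner_add_left) auto
  then have eq: "2 * (frob_norm Z)\<^sup>2 = - mat_inner Z T - mat_inner G (G * Y) - mat_inner C (C * Y)"
    unfolding M(2) 1 2 3 by simp
  have nY: "frob_norm Y = frob_norm Z"
    unfolding Y_def using car W by (intro frob_norm_isometry) auto
  have "\<bar>mat_inner Z T\<bar> \<le> frob_norm Z * (frob_norm Z * frob_norm Z)"
    using mat_inner_Cauchy_Schwarz[of Z n n T] frob_norm_mult[of Z n n Y n] car nY
    by (metis T_def frob_norm_nonneg mult_left_mono order_trans)
  moreover have "\<bar>mat_inner G (G * Y)\<bar> \<le> frob_norm G * (frob_norm G * frob_norm Z)"
    using mat_inner_Cauchy_Schwarz[of G n n "G * Y"] frob_norm_mult[of G n n Y n] car nY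
    by (metis frob_norm_nonneg mult_left_mono order_trans)
  moreover have "\<bar>mat_inner C (C * Y)\<bar> \<le> frob_norm C * frob_norm Z"
    using mat_inner_Cauchy_Schwarz[of C m n "C * Y"] frob_norm_contraction[of M n C m Y n] car nY M(2)
    by (metis frob_norm_nonneg mult_left_mono order_trans)
  ultimately have "2 * (frob_norm Z)\<^sup>2 \<le> (frob_norm Z * frob_norm Z + (frob_norm G)\<^sup>2 + frob_norm C) * frob_norm Z"
    using eq by (simp add: algebra_simps power2_eq_square)
  then have le: "2 * frob_norm Z * frob_norm Z \<le> (frob_norm Z * frob_norm Z + (frob_norm G)\<^sup>2 + frob_norm C) * frob_norm Z"
    by (simp add: power2_eq_square)
  \<comment> \<open>After one factor \<open>|Z|\<close> is cancelled, the quadratic term on the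
    right is at most \<open>|Z|\<close> and is absorbed by the left side.\<close>
  have "frob_norm Z * frob_norm Z \<le> frob_norm Z"
    using Z(3) by (simp add: mult_left_le)
  show ?thesis
  proof (cases "frob_norm Z = 0")
    case False
    then have "0 < frob_norm Z" using frob_norm_nonneg[of Z] by linarith
    with le have "2 * frob_norm Z \<le> frob_norm Z * frob_norm Z + (frob_norm G)\<^sup>2 + frob_norm C"
      by (rule mult_right_le_imp_le)
    with \<open>frob_norm Z * frob_norm Z \<le> frob_norm Z\<close> show ?thesis by linarith
  qed simp
qed

section \<open>Replacing the lower right block by one with orthonormal columns\<close>

text \<open>In this expansion \<open>C\<close> occurs only in \<open>C^T Y\<close> and
  \<open>C^T C\<close>, which the isometry relations express through \<open>M\<close> and
  \<open>B\<close>. The same expansion serves for \<open>B - M * L\<close>.\<close>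

lemma transpose_diff_mult:
  fixes Y C L :: "real mat"
  assumes "Y \<in> carrier_mat m k" "C \<in> carrier_mat m n" "L \<in> carrier_mat n k"
  shows "transpose_mat (Y - C * L) * (Y - C * L) = transpose_mat Y * Y
    - transpose_mat (transpose_mat C * Y) * L - transpose_mat L * (transpose_mat C * Y)
    + transpose_mat L * ((transpose_mat C * C) * L)"
proof -
  have c: "transpose_mat Y \<in> carrier_mat k m" "transpose_mat C \<in> carrier_mat n m"
    "transpose_mat L \<in> carrier_mat k n" "C * L \<in> carrier_mat m k"
    "Y - C * L \<in> carrier_mat m k" "transpose_mat L * transpose_mat C \<in> carrier_mat k m"
    using assms by (auto intro!: minus_carrier_mat)
  have "transpose_mat (Y - C * L) = transpose_mat Y - transpose_mat L * transpose_mat C"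
    unfolding transpose_minus[OF assms(1) c(4)] transpose_mult[OF assms(2,3)] ..
  then have "transpose_mat (Y - C * L) * (Y - C * L)
    = transpose_mat Y * (Y - C * L) - transpose_mat L * transpose_mat C * (Y - C * L)"
    using minus_mult_distrib_mat[OF c(1) c(6) c(5)] by simp
  also have "transpose_mat Y * (Y - C * L) = transpose_mat Y * Y - transpose_mat (transpose_mat C * Y) * L"
    using assms c by (simp add: mult_minus_distrib_mat[of _ k m _ k] transpose_mult[OF c(2) assms(1)]
        assoc_mult_mat[of _ k m _ n _ k])
  also have "transpose_mat L * transpose_mat C * (Y - C * L)
    = transpose_mat L * (transpose_mat C * Y) - transpose_mat L * ((transpose_mat C * C) * L)"
    using assms c by (simp add: mult_minus_distrib_mat[of _ k m _ k] assoc_mult_mat[of _ k n _ m _ k]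
        assoc_mult_mat[of _ n m _ n _ k])
  finally have *: "transpose_mat (Y - C * L) * (Y - C * L) =
    (transpose_mat Y * Y - transpose_mat (transpose_mat C * Y) * L)
    - (transpose_mat L * (transpose_mat C * Y) - transpose_mat L * ((transpose_mat C * C) * L))" .
  show ?thesis unfolding * using assms c by (intro eq_matI) (auto simp del: index_mult_mat(1))
qed

text \<open>Closing the first block of the isometry by the orthogonal feedback \<open>- W\<^sup>T\<close> leaves an isometry
  on the second block, since the signals fed back have equal norms.\<close>
lemma isometry_feedback:
  assumes carrier: "M \<in> carrier_mat n n" "B \<in> carrier_mat n k" "C \<in> carrier_mat m n" "Y \<in> carrier_mat m k"
    and iso: "transpose_mat M * M + transpose_mat C * C = 1\<^sub>m n"
      "transpose_mat M * B + transpose_mat C * Y = 0\<^sub>m n k"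
      "transpose_mat B * B + transpose_mat Y * Y = 1\<^sub>m k"
    and W: "orthogonal_mat n W" "frob_norm (M - W) < 1"
  shows "\<exists>V. stiefel m k V \<and> frob_norm (Y - V) \<le> frob_norm B"
proof -
  let ?Wt = "transpose_mat W"
  have WC: "W \<in> carrier_mat n n" "?Wt \<in> carrier_mat n n" and WtW: "?Wt * W = 1\<^sub>m n"
    using W by (simp_all add: orthogonal_mat_def)
  have WWt: "W * ?Wt = 1\<^sub>m n" using orthogonal_mat_transpose[OF W(1)] .
  have nW: "frob_norm (?Wt * N) = frob_norm N" if "N \<in> carrier_mat n j" for N j
    using frob_norm_isometry[of ?Wt n n N j] WC WWt that by simp
  \<comment> \<open>Substituting the feedback \<open>L = W^T N\<close> into
    \<open>N = B - M L\<close> gives the linear equation \<open>T N = B\<close>.\<close>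
  define T where "T = 1\<^sub>m n + M * ?Wt"
  have TC: "T \<in> carrier_mat n n" using carrier WC by (simp add: T_def)
  have TN: "T * N = N + M * (?Wt * N)" if "N \<in> carrier_mat n j" for N j
    unfolding T_def using carrier WC that
    by (subst add_mult_distrib_mat[of _ n n _ _ j]) (auto simp: assoc_mult_mat[of _ n n _ n _ j])
  \<comment> \<open>\<open>2 N = T N - E\<close> with \<open>E = (M - W) W^T N\<close>, whose norm
    is at most that of \<open>N\<close> because \<open>M\<close> is within distance 1 of
    \<open>W\<close>. This yields both the invertibility of \<open>T\<close> and, later,
    \<open>|N| <= |B|\<close>.\<close>
  have lower: "frob_norm N \<le> frob_norm (T * N)" if N: "N \<in> carrier_mat n j" for N j
  proof -
    define E where "E = (M - W) * (?Wt * N)"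
    have EC: "E \<in> carrier_mat n j"
      unfolding E_def using minus_carrier_mat[OF WC(1), of M] WC N by (intro mult_carrier_mat) auto
    have WWN: "W * (?Wt * N) = N"
      by (simp only: assoc_mult_mat[OF WC N, symmetric] WWt left_mult_one_mat[OF N])
    have "E = M * (?Wt * N) - N"
      unfolding E_def using carrier WC N
      by (simp add: minus_mult_distrib_mat[of _ n n _ _ j] WWN)
    then have "N + N = T * N + - E"
      unfolding TN[OF N] using carrier WC N by (intro eq_matI) (auto simp del: index_mult_mat(1))
    moreover have "frob_norm (- E) = frob_norm E" by (simp add: frob_norm_def)
    ultimately have "frob_norm (N + N) \<le> frob_norm (T * N) + frob_norm E"
      using frob_norm_triangle[of "T * N" n j "- E"] EC TC N by simp
    moreover have "frob_norm (N + N) = 2 * frob_norm N"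
    proof (rule power2_eq_imp_eq)
      show "(frob_norm (N + N))\<^sup>2 = (2 * frob_norm N)\<^sup>2"
        using frob_norm_add_sq[OF N N] by (simp add: frob_norm_sq power_mult_distrib)
    qed simp_all
    moreover have "frob_norm E \<le> frob_norm N"
    proof -
      have "frob_norm E \<le> frob_norm (M - W) * frob_norm (?Wt * N)"
        unfolding E_def using carrier WC N by (intro frob_norm_mult) (auto intro: minus_carrier_mat)
      also have "\<dots> \<le> 1 * frob_norm N"
        unfolding nW[OF N] using W(2) by (intro mult_right_mono) auto
      finally show ?thesis by simp
    qed
    ultimately show ?thesis by simp
  qed
  obtain S where S: "S \<in> carrier_mat n n" "T * S = 1\<^sub>m n"
  proof -
    have "N = 0\<^sub>m n 1" if "N \<in> carrier_mat n 1" "T * N = 0\<^sub>m n 1" for N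
    proof -
      have "frob_norm (0\<^sub>m n 1) = 0" by (simp add: frob_norm_def)
      then have "frob_norm N \<le> 0" using lower[OF that(1)] unfolding that(2) by simp
      then show ?thesis using frob_norm_nonneg[of N] by (intro frob_norm_eq_0[OF that(1)]) linarith
    qed
    then show ?thesis using mat_right_inverse_exists[OF TC] that by blast
  qed
  define N where "N = S * B"
  define L where "L = ?Wt * N"
  have NC: "N \<in> carrier_mat n k" and LC: "L \<in> carrier_mat n k"
    using S carrier WC by (auto simp: N_def L_def)
  have TNB: "T * N = B"
    unfolding N_def
    by (simp only: assoc_mult_mat[OF TC S(1) carrier(2), symmetric] S(2) left_mult_one_mat[OF carrier(2)])
  have N: "N = B - M * L"
    using TN[OF NC] NC LC carrier unfolding TNB L_def[symmetric]
    by (intro eq_matI) (auto simp del: index_mult_mat(1))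
  have nN: "frob_norm N \<le> frob_norm B" using lower[OF NC] TNB by simp
  \<comment> \<open>The isometry sends the block column of \<open>- L\<close> and \<open>I\<close>
    to that of \<open>N\<close> and \<open>V\<close>. Hence
    \<open>L^T L + I = N^T N + V^T V\<close>, and \<open>L^T L = N^T N\<close> leaves
    \<open>V^T V = I\<close>.\<close>
  define V where "V = Y - C * L"
  have VC: "V \<in> carrier_mat m k" using carrier LC by (simp add: V_def minus_carrier_mat)
  have LL: "transpose_mat L * L = transpose_mat N * N"
  proof -
    have "transpose_mat L = transpose_mat N * W"
      unfolding L_def using WC NC by (simp add: transpose_mult[OF WC(2) NC])
    moreover have "W * (?Wt * N) = N"
      by (simp only: assoc_mult_mat[OF WC NC, symmetric] WWt left_mult_one_mat[OF NC])
    ultimately show ?thesis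
      unfolding L_def using WC NC by (simp add: assoc_mult_mat[of _ k n _ n _ k])
  qed
  \<comment> \<open>With these names the remaining computation is linear:
    \<open>L^T L = N^T N\<close> reads \<open>l = b - e - f + h\<close>, and \<open>V^T V\<close>
    expands to the identity minus this combination plus \<open>l\<close>.\<close>
  define b e f h l where "b = transpose_mat B * B" and "e = transpose_mat (transpose_mat M * B) * L"
    and "f = transpose_mat L * (transpose_mat M * B)" and "h = transpose_mat L * ((transpose_mat M * M) * L)"
    and "l = transpose_mat L * L"
  have kk: "b \<in> carrier_mat k k" "e \<in> carrier_mat k k" "f \<in> carrier_mat k k" "h \<in> carrier_mat k k"
    "l \<in> carrier_mat k k"
    using carrier LC by (auto simp: b_def e_def f_def h_def l_def)
  have NN: "l = b - e - f + h"
    unfolding l_def LL unfolding N unfolding b_def e_def f_def h_def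
    using carrier LC by (intro transpose_diff_mult) auto
  have CY: "transpose_mat C * Y = - (transpose_mat M * B)"
  proof (rule eq_matI)
    fix i j assume "i < dim_row (- (transpose_mat M * B))" "j < dim_col (- (transpose_mat M * B))"
    then have ij: "i < n" "j < k" using carrier by auto
    have "(transpose_mat M * B + transpose_mat C * Y) $$ (i, j) = 0" using iso(2) ij by simp
    then show "(transpose_mat C * Y) $$ (i, j) = (- (transpose_mat M * B)) $$ (i, j)"
      using ij carrier by (simp del: index_mult_mat(1))
  qed (use carrier in auto)
  have CC: "transpose_mat C * C = 1\<^sub>m n - transpose_mat M * M"
    unfolding iso(1)[symmetric] using carrier by (intro eq_matI) (auto simp del: index_mult_mat(1))
  have YY: "transpose_mat Y * Y = 1\<^sub>m k - b"
    unfolding iso(3)[symmetric] b_def using carrier by (intro eq_matI) (auto simp del: index_mult_mat(1))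
  have MB: "transpose_mat M * B \<in> carrier_mat n k" using carrier by simp
  have e': "transpose_mat (transpose_mat C * Y) * L = - e"
    unfolding CY e_def transpose_uminus using carrier LC by (intro uminus_mult_left_mat) auto
  have f': "transpose_mat L * (transpose_mat C * Y) = - f"
    unfolding CY f_def using carrier LC by (intro uminus_mult_right_mat) auto
  have h': "transpose_mat L * ((transpose_mat C * C) * L) = l - h"
    unfolding CC h_def l_def using carrier LC
    by (simp add: minus_mult_distrib_mat[of _ n n _ _ k] mult_minus_distrib_mat[of _ k n _ k])
  have "transpose_mat V * V = (1\<^sub>m k - b) - (- e) - (- f) + (l - h)"
    unfolding V_def using transpose_diff_mult[OF carrier(4,3) LC] unfolding e' f' h' YY .
  also have "\<dots> = 1\<^sub>m k"
    unfolding NN using kk by (intro eq_matI) auto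
  finally have "stiefel m k V" using VC by (simp add: stiefel_def)
  moreover have "frob_norm (Y - V) \<le> frob_norm B"
  proof -
    have "Y - V = C * L"
      unfolding V_def using carrier LC by (intro eq_matI) (auto simp del: index_mult_mat(1))
    then have "frob_norm (Y - V) \<le> frob_norm L"
      using frob_norm_contraction[OF carrier(1,3) LC iso(1)] by simp
    then show ?thesis using nW[OF NC] nN by (simp add: L_def)
  qed
  ultimately show ?thesis by blast
qed

section \<open>The residual and its blocks\<close>

lemma sum_lessThan_add:
  fixes f :: "nat \<Rightarrow> 'a :: comm_monoid_add"
  shows "(\<Sum>i<n + m. f i) = (\<Sum>i<n. f i) + (\<Sum>i<m. f (n + i))"
  by (induction m) (simp_all add: add.assoc)

lemma frob_norm_four_block:
  assumes "A \<in> carrier_mat n k" "B \<in> carrier_mat n l" "C \<in> carrier_mat m k" "D \<in> carrier_mat m l"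
  shows "(frob_norm (four_block_mat A B C D))\<^sup>2
    = (frob_norm A)\<^sup>2 + (frob_norm B)\<^sup>2 + (frob_norm C)\<^sup>2 + (frob_norm D)\<^sup>2"
proof -
  have "four_block_mat A B C D \<in> carrier_mat (n + m) (k + l)" using assms by auto
  then show ?thesis
    using assms by (simp add: frob_norm_sq_eq[of _ "n + m" "k + l"] frob_norm_sq_eq[of A n k]
        frob_norm_sq_eq[of B n l] frob_norm_sq_eq[of C m k] frob_norm_sq_eq[of D m l]
        sum_lessThan_add sum.distrib)
qed

lemma diff_four_block_mat:
  fixes A A' :: "real mat"
  assumes "A \<in> carrier_mat n k" "B \<in> carrier_mat n l" "C \<in> carrier_mat m k" "D \<in> carrier_mat m l"
    "A' \<in> carrier_mat n k" "B' \<in> carrier_mat n l" "C' \<in> carrier_mat m k" "D' \<in> carrier_mat m l"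
  shows "four_block_mat A B C D - four_block_mat A' B' C' D'
    = four_block_mat (A - A') (B - B') (C - C') (D - D')"
  using assms by (intro eq_matI) auto

text \<open>When the three squares are expanded, every cross term is the same number
  \<open>\<tau>\<close>, and because \<open>X\<close> is an isometry every squared norm is either
  \<open>|S|^2\<close> or \<open>|X^T S|^2\<close>.\<close>

lemma stiefel_residual_identity:
  assumes X: "X \<in> carrier_mat d k" "transpose_mat X * X = 1\<^sub>m k" and S: "S \<in> carrier_mat d k"
  shows "(frob_norm (transpose_mat X * S - transpose_mat S * X))\<^sup>2
      + (frob_norm (S * transpose_mat X - X * transpose_mat S))\<^sup>2
    = 2 * (frob_norm (S - X * transpose_mat S * X))\<^sup>2"
proof -
  let ?Xt = "transpose_mat X" and ?St = "transpose_mat S"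
  have c: "?Xt \<in> carrier_mat k d" "?St \<in> carrier_mat k d" "?Xt * S \<in> carrier_mat k k"
    "?St * X \<in> carrier_mat k k" "S * ?Xt \<in> carrier_mat d d" "X * ?St \<in> carrier_mat d d"
    "X * ?St * X \<in> carrier_mat d k"
    using X S by auto
  define \<tau> where "\<tau> = mat_inner S (X * ?St * X)"
  have assoc: "X * ?St * X = X * (?St * X)" by (rule assoc_mult_mat[OF X(1) c(2) X(1)])
  have tr: "transpose_mat (?Xt * S) = ?St * X" using transpose_mult[OF c(1) S] by simp
  have 1: "mat_inner (?Xt * S) (?St * X) = \<tau>"
    unfolding \<tau>_def assoc using mat_inner_mult_left[OF c(1) S c(4)] by simp
  have 2: "mat_inner (S * ?Xt) (X * ?St) = \<tau>"
    unfolding \<tau>_def using mat_inner_mult_right[OF S c(1) c(6)] by simp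
  have 3: "frob_norm (?St * X) = frob_norm (?Xt * S)" by (metis tr frob_norm_transpose)
  have 4: "frob_norm (S * ?Xt) = frob_norm S" by (rule frob_norm_isometry_right[OF X S])
  have 5: "frob_norm (X * ?St) = frob_norm S" using frob_norm_isometry[OF X c(2)] by simp
  have 6: "frob_norm (X * ?St * X) = frob_norm (?Xt * S)"
    unfolding assoc frob_norm_isometry[OF X c(4)] by (rule 3)
  show ?thesis
    unfolding frob_norm_diff_sq[OF c(3,4)] frob_norm_diff_sq[OF c(5,6)] frob_norm_diff_sq[OF S c(7)]
      1 2 3 4 5 6 \<tau>_def[symmetric] by simp
qed

section \<open>Distance of \<open>M\<close> to the symmetric block matrices\<close>

text \<open>The orthogonal projection of \<open>M\<close> onto the symmetric matrices supported on
  the blocks of \<open>c\<close>.\<close>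

definition symmetric_block_part :: "(nat \<Rightarrow> real) \<Rightarrow> nat \<Rightarrow> real mat \<Rightarrow> real mat" where
  "symmetric_block_part c n M =
    mat n n (\<lambda>(i, j). if c i = c j then (M $$ (i, j) + M $$ (j, i)) / 2 else 0)"

text \<open>Inside a block the difference is the skew part of \<open>M\<close>, which pairs to zero
  with a symmetric matrix; outside the blocks \<open>Y\<close> vanishes.\<close>

lemma symmetric_block_part_orthogonal:
  assumes M: "M \<in> carrier_mat n n" and Y: "Y \<in> carrier_mat n n" "transpose_mat Y = Y" "block_supported c n Y"
  shows "mat_inner (M - symmetric_block_part c n M) Y = 0"
proof -
  let ?G = "M - symmetric_block_part c n M"
  define f where "f i j = (if c i = c j then (M $$ (i, j) - M $$ (j, i)) / 2 * Y $$ (i, j) else 0)" for i j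
  have sym: "Y $$ (i, j) = Y $$ (j, i)" if "i < n" "j < n" for i j
    using Y that by (metis carrier_matD index_transpose_mat(1))
  have GC: "?G \<in> carrier_mat n n" by (simp add: symmetric_block_part_def minus_carrier_mat)
  have f: "?G $$ (i, j) * Y $$ (i, j) = f i j" if "i < n" "j < n" for i j
    using that M Y(3) by (auto simp: f_def symmetric_block_part_def block_supported_def field_simps)
  have s1: "mat_inner ?G Y = (\<Sum>i<n. \<Sum>j<n. f i j)"
    unfolding mat_inner_eq[OF GC] by (intro sum.cong refl) (simp add: f del: index_minus_mat)
  have s2: "(\<Sum>i<n. \<Sum>j<n. f i j) = (\<Sum>i<n. \<Sum>j<n. f j i)" by (rule sum.swap)
  have anti: "f j i = - f i j" if "i < n" "j < n" for i j
    unfolding f_def sym[OF that] by (simp add: algebra_simps diff_divide_distrib)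
  have "(\<Sum>i<n. \<Sum>j<n. f j i) = (\<Sum>i<n. \<Sum>j<n. - f i j)"
    by (intro sum.cong refl anti) auto
  then have "(\<Sum>i<n. \<Sum>j<n. f j i) = - (\<Sum>i<n. \<Sum>j<n. f i j)" by (simp only: sum_negf)
  with s1 s2 show ?thesis by linarith
qed

text \<open>Here \<open>u\<close> and \<open>v\<close> stand for two mirrored entries of
  \<open>M\<close>, and the two squares are residual entries linear in them. Eliminating
  \<open>v\<close> leaves \<open>u (x / y - y / x)\<close>, and \<open>\<iota>\<close> bounds the
  reciprocal square of that gap from above.\<close>

lemma off_block_entry_bound:
  fixes x y :: real
  assumes pos: "0 < m" "m \<le> x" "m \<le> y" and gap: "1 \<le> \<iota> * (x / y - y / x)\<^sup>2" and "0 \<le> \<iota>"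
  shows "m\<^sup>2 * u\<^sup>2 \<le> 2 * \<iota> * ((v * y - x * u)\<^sup>2 + (x * v - u * y)\<^sup>2)"
proof -
  define e1 e2 where "e1 = v * y - x * u" and "e2 = x * v - u * y"
  have xy: "0 < x" "0 < y" using pos by auto
  have eq: "u * (x / y - y / x) = e2 / x - e1 / y"
    using xy by (simp add: e1_def e2_def field_simps)
  \<comment> \<open>Scaling by \<open>m\<close> makes the coefficients \<open>m / x\<close> and
    \<open>m / y\<close> at most 1.\<close>
  have "m\<^sup>2 * (u * (x / y - y / x))\<^sup>2 = (m / x * e2 - m / y * e1)\<^sup>2"
    unfolding eq by (simp only: power_mult_distrib[symmetric]) (simp add: algebra_simps)
  also have "\<dots> \<le> 2 * ((m / x * e2)\<^sup>2 + (m / y * e1)\<^sup>2)"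
  proof -
    have "(s - t)\<^sup>2 \<le> 2 * (s\<^sup>2 + t\<^sup>2)" for s t :: real
      using zero_le_power2[of "s + t"] by (simp add: power2_eq_square algebra_simps)
    then show ?thesis .
  qed
  also have "\<dots> \<le> 2 * (e2\<^sup>2 + e1\<^sup>2)"
  proof -
    have "(m / x)\<^sup>2 \<le> 1" "(m / y)\<^sup>2 \<le> 1" using pos xy by (simp_all add: power_le_one)
    then have "(m / x)\<^sup>2 * e2\<^sup>2 \<le> 1 * e2\<^sup>2" "(m / y)\<^sup>2 * e1\<^sup>2 \<le> 1 * e1\<^sup>2" by (intro mult_right_mono; simp)+
    then show ?thesis unfolding power_mult_distrib by simp
  qed
  finally have le: "m\<^sup>2 * (u * (x / y - y / x))\<^sup>2 \<le> 2 * (e2\<^sup>2 + e1\<^sup>2)" .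
  have "m\<^sup>2 * u\<^sup>2 * 1 \<le> m\<^sup>2 * u\<^sup>2 * (\<iota> * (x / y - y / x)\<^sup>2)"
    using gap by (intro mult_left_mono) auto
  also have "\<dots> = \<iota> * (m\<^sup>2 * (u * (x / y - y / x))\<^sup>2)" by (simp add: power_mult_distrib)
  also have "\<dots> \<le> \<iota> * (2 * (e2\<^sup>2 + e1\<^sup>2))" using le \<open>0 \<le> \<iota>\<close> by (rule mult_left_mono)
  finally show ?thesis by (simp add: e1_def e2_def algebra_simps)
qed

text \<open>The estimate holds entry by entry. Within a block the entry of the difference is half of
  the difference of mirrored entries of \<open>M\<close>, and the first residual alone gives the
  factor \<open>1 / 4\<close>; between blocks the elimination above gives
  \<open>2 * \<iota>\<close>. The sum of the two covers both cases.\<close>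

lemma off_symmetric_block_part_bound:
  assumes M: "M \<in> carrier_mat n n" and m: "0 < m" "\<And>k. k < n \<Longrightarrow> m \<le> c k" and "0 \<le> \<iota>"
    and gap: "\<And>k l. k < n \<Longrightarrow> l < n \<Longrightarrow> c k \<noteq> c l \<Longrightarrow> 1 \<le> \<iota> * (c k / c l - c l / c k)\<^sup>2"
  shows "m\<^sup>2 * (frob_norm (M - symmetric_block_part c n M))\<^sup>2 \<le> (1 / 4 + 2 * \<iota>) *
    ((frob_norm (transpose_mat M * diag_mat_of n c - diag_mat_of n c * M))\<^sup>2
      + (frob_norm (diag_mat_of n c * transpose_mat M - M * diag_mat_of n c))\<^sup>2)"
proof -
  let ?D = "diag_mat_of n c" and ?Mt = "transpose_mat M"
  define e1 e2 where "e1 k l = M $$ (l, k) * c l - c k * M $$ (k, l)"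
    and "e2 k l = c k * M $$ (l, k) - M $$ (k, l) * c l" for k l
  define g where "g k l = (M - symmetric_block_part c n M) $$ (k, l)" for k l
  have Mt: "?Mt \<in> carrier_mat n n" using M by simp
  have cs: "?Mt * ?D \<in> carrier_mat n n" "?D * M \<in> carrier_mat n n"
    "?D * ?Mt \<in> carrier_mat n n" "M * ?D \<in> carrier_mat n n"
    using mult_carrier_mat[OF Mt diag_mat_of_carrier] mult_carrier_mat[OF diag_mat_of_carrier M]
      mult_carrier_mat[OF diag_mat_of_carrier Mt] mult_carrier_mat[OF M diag_mat_of_carrier] by auto
  have 1: "(frob_norm (?Mt * ?D - ?D * M))\<^sup>2 = (\<Sum>k<n. \<Sum>l<n. (e1 k l)\<^sup>2)"
  proof -
    have "(?Mt * ?D - ?D * M) $$ (k, l) = e1 k l" if "k < n" "l < n" for k l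
      using that M cs by (simp add: mult_diag_mat_of_index[OF Mt] diag_mat_of_mult_index[OF M] e1_def
          del: index_mult_mat(1))
    moreover have "?Mt * ?D - ?D * M \<in> carrier_mat n n" using cs by (simp add: minus_carrier_mat)
    ultimately show ?thesis by (simp add: frob_norm_sq_eq del: index_minus_mat)
  qed
  have 2: "(frob_norm (?D * ?Mt - M * ?D))\<^sup>2 = (\<Sum>k<n. \<Sum>l<n. (e2 k l)\<^sup>2)"
  proof -
    have "(?D * ?Mt - M * ?D) $$ (k, l) = e2 k l" if "k < n" "l < n" for k l
      using that M cs by (simp add: mult_diag_mat_of_index[OF M] diag_mat_of_mult_index[OF Mt] e2_def
          del: index_mult_mat(1))
    moreover have "?D * ?Mt - M * ?D \<in> carrier_mat n n" using cs by (simp add: minus_carrier_mat)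
    ultimately show ?thesis by (simp add: frob_norm_sq_eq del: index_minus_mat)
  qed
  have GC: "M - symmetric_block_part c n M \<in> carrier_mat n n"
    by (simp add: symmetric_block_part_def minus_carrier_mat)
  have 3: "(frob_norm (M - symmetric_block_part c n M))\<^sup>2 = (\<Sum>k<n. \<Sum>l<n. (g k l)\<^sup>2)"
    unfolding frob_norm_sq_eq[OF GC] g_def ..
  have entry: "m\<^sup>2 * (g k l)\<^sup>2 \<le> (1 / 4 + 2 * \<iota>) * ((e1 k l)\<^sup>2 + (e2 k l)\<^sup>2)" if kl: "k < n" "l < n" for k l
  proof (cases "c k = c l")
    case True
    have g: "g k l = (M $$ (k, l) - M $$ (l, k)) / 2"
      using True kl M by (simp add: g_def symmetric_block_part_def field_simps)
    have "4 * (m\<^sup>2 * (g k l)\<^sup>2) = m\<^sup>2 * (M $$ (l, k) - M $$ (k, l))\<^sup>2"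
      unfolding g power2_commute[of "M $$ (l, k)"] by (simp add: power_divide)
    also have "\<dots> \<le> (c k)\<^sup>2 * (M $$ (l, k) - M $$ (k, l))\<^sup>2"
      using m kl by (intro mult_right_mono power_mono) (auto intro: less_imp_le)
    also have "\<dots> = (e1 k l)\<^sup>2"
      using True by (simp add: e1_def power_mult_distrib[symmetric] algebra_simps)
    finally have "m\<^sup>2 * (g k l)\<^sup>2 \<le> 1 / 4 * (e1 k l)\<^sup>2" by simp
    also have "\<dots> \<le> (1 / 4 + 2 * \<iota>) * ((e1 k l)\<^sup>2 + (e2 k l)\<^sup>2)"
      using \<open>0 \<le> \<iota>\<close> by (intro mult_mono) auto
    finally show ?thesis .
  next
    case False
    then have "g k l = M $$ (k, l)" using kl M by (simp add: g_def symmetric_block_part_def)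
    then have "m\<^sup>2 * (g k l)\<^sup>2 \<le> 2 * \<iota> * ((e1 k l)\<^sup>2 + (e2 k l)\<^sup>2)"
      using off_block_entry_bound[OF m(1) m(2)[OF kl(1)] m(2)[OF kl(2)] gap[OF kl False] \<open>0 \<le> \<iota>\<close>,
          of "M $$ (k, l)" "M $$ (l, k)"] by (simp add: e1_def e2_def)
    also have "\<dots> \<le> (1 / 4 + 2 * \<iota>) * ((e1 k l)\<^sup>2 + (e2 k l)\<^sup>2)"
      by (intro mult_right_mono) auto
    finally show ?thesis .
  qed
  have "m\<^sup>2 * (\<Sum>k<n. \<Sum>l<n. (g k l)\<^sup>2) = (\<Sum>k<n. \<Sum>l<n. m\<^sup>2 * (g k l)\<^sup>2)"
    by (simp add: sum_distrib_left)
  also have "\<dots> \<le> (\<Sum>k<n. \<Sum>l<n. (1 / 4 + 2 * \<iota>) * ((e1 k l)\<^sup>2 + (e2 k l)\<^sup>2))"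
    using entry by (intro sum_mono) auto
  also have "\<dots> = (1 / 4 + 2 * \<iota>) * ((\<Sum>k<n. \<Sum>l<n. (e1 k l)\<^sup>2) + (\<Sum>k<n. \<Sum>l<n. (e2 k l)\<^sup>2))"
    by (simp only: sum.distrib sum_distrib_left distrib_left)
  finally show ?thesis unfolding 1 2 3 .
qed

text \<open>As the entries of \<open>q\<close> are signs, \<open>diag_mat_of n q\<close> squares to
  the identity; conjugation by \<open>U\<close> keeps this, so \<open>W\<close> is at once symmetric
  and orthogonal.\<close>

lemma involution_conj_diag:
  assumes U: "orthogonal_mat n U" "block_supported c n U" and q: "\<And>k. k < n \<Longrightarrow> q k = 1 \<or> q k = - 1"
  defines "W \<equiv> U * diag_mat_of n q * transpose_mat U"
  shows "W \<in> carrier_mat n n" "transpose_mat W = W" "W * W = 1\<^sub>m n" "block_supported c n W"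
proof -
  define J where "J = diag_mat_of n q"
  let ?T = "transpose_mat U"
  have c: "U \<in> carrier_mat n n" "?T \<in> carrier_mat n n" "J \<in> carrier_mat n n" "U * J \<in> carrier_mat n n"
    and UU: "?T * U = 1\<^sub>m n"
    using U by (auto simp: orthogonal_mat_def J_def)
  have W: "W = U * J * ?T" by (simp add: W_def J_def)
  have W': "W = U * (J * ?T)" unfolding W by (rule assoc_mult_mat[OF c(1,3,2)])
  show WC: "W \<in> carrier_mat n n" unfolding W using c by simp
  have "transpose_mat W = U * (transpose_mat (U * J))"
    unfolding W transpose_mult[OF c(4,2)] by simp
  also have "\<dots> = U * (J * ?T)" unfolding transpose_mult[OF c(1,3)] by (simp add: J_def)
  finally show "transpose_mat W = W" using W' by simp
  have JJ: "J * J = 1\<^sub>m n"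
  proof (rule eq_matI)
    fix i j assume "i < dim_row (1\<^sub>m n :: real mat)" "j < dim_col (1\<^sub>m n :: real mat)"
    then have ij: "i < n" "j < n" by auto
    then show "(J * J) $$ (i, j) = 1\<^sub>m n $$ (i, j)"
      using q[of i] mult_diag_mat_of_index[OF c(3) ij, of q] by (auto simp: J_def simp del: index_mult_mat)
  qed (use c in auto)
  have "W * W = U * J * (?T * (U * (J * ?T)))"
    using W W' assoc_mult_mat[OF c(4,2) WC] by simp
  also have "?T * (U * (J * ?T)) = J * ?T"
    using assoc_mult_mat[OF c(2,1) mult_carrier_mat[OF c(3,2)]] UU
      left_mult_one_mat[OF mult_carrier_mat[OF c(3,2)]] by simp
  also have "U * J * (J * ?T) = U * (J * J * ?T)"
    using assoc_mult_mat[OF c(1,3) mult_carrier_mat[OF c(3,2)]] assoc_mult_mat[OF c(3,3,2)] by simp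
  also have "\<dots> = 1\<^sub>m n" unfolding JJ using c(2) orthogonal_mat_transpose[OF U(1)] by simp
  finally show "W * W = 1\<^sub>m n" .
  show "block_supported c n W"
    unfolding W using U c by (intro block_supported_mult block_supported_transpose)
      (auto simp: J_def block_supported_diag)
qed

text \<open>All orbit points have the same norm, so the maximizer of the pairing with
  \<open>H\<close> yields the orbit point nearest to \<open>H\<close>. It commutes with
  \<open>H\<close> and is within distance 1 of it because the point given by \<open>U0\<close> is.
  The block \<open>V\<close> comes separately, from the feedback construction.\<close>

lemma stationary_approximation:
  assumes carrier: "M \<in> carrier_mat n n" "B \<in> carrier_mat n k" "C \<in> carrier_mat m n" "Y \<in> carrier_mat m k"
    and iso: "transpose_mat M * M + transpose_mat C * C = 1\<^sub>m n"
      "transpose_mat M * B + transpose_mat C * Y = 0\<^sub>m n k"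
      "transpose_mat B * B + transpose_mat Y * Y = 1\<^sub>m k"
    and q: "\<And>k. k < n \<Longrightarrow> q k = 1 \<or> q k = - 1"
    and U0: "orthogonal_mat n U0" "block_supported c n U0"
      "frob_norm (M - U0 * diag_mat_of n q * transpose_mat U0) < 1"
  shows "\<exists>U V. orthogonal_mat n U \<and> block_supported c n U \<and> stiefel m k V \<and>
    (frob_norm (M - U * diag_mat_of n q * transpose_mat U))\<^sup>2 + (frob_norm (Y - V))\<^sup>2
      \<le> 3 * (frob_norm (M - symmetric_block_part c n M))\<^sup>2 + (frob_norm B)\<^sup>2 + 2 * (frob_norm C)\<^sup>2"
proof -
  define H where "H = symmetric_block_part c n M"
  define G where "G = M - H"
  let ?J = "diag_mat_of n q"
  have HC: "H \<in> carrier_mat n n" by (simp add: H_def symmetric_block_part_def)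
  have GC: "G \<in> carrier_mat n n" using HC by (simp add: G_def minus_carrier_mat)
  have Ht: "transpose_mat H = H"
    by (intro eq_matI) (auto simp: H_def symmetric_block_part_def add.commute)
  have Hb: "block_supported c n H" by (simp add: H_def symmetric_block_part_def block_supported_def)
  have G0: "mat_inner G Z = 0" if "Z \<in> carrier_mat n n" "transpose_mat Z = Z" "block_supported c n Z" for Z
    unfolding G_def H_def using carrier(1) that by (rule symmetric_block_part_orthogonal)
  obtain U where U: "orthogonal_mat n U" "block_supported c n U"
    and max: "\<And>U'. orthogonal_mat n U' \<Longrightarrow> block_supported c n U' \<Longrightarrow>
      mat_inner H (U' * ?J * transpose_mat U') \<le> mat_inner H (U * ?J * transpose_mat U)"
    using ex_max_conj_diag[OF HC, of c q] by blast
  define W W0 where "W = U * ?J * transpose_mat U" and "W0 = U0 * ?J * transpose_mat U0"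
  note W = involution_conj_diag[where q = q, OF U q, folded W_def]
  note W0 = involution_conj_diag[where q = q, OF U0(1,2) q, folded W0_def]
  have HW: "H * W = W * H"
    unfolding W_def by (rule max_conj_diag_commute[OF HC Ht Hb U max])
  \<comment> \<open>\<open>G\<close> is orthogonal to the symmetric block matrix
    \<open>H - V\<close>, so squared distances from \<open>M\<close> split off the fixed part
    \<open>|G|^2\<close>.\<close>
  have pythagoras: "(frob_norm (M - V))\<^sup>2 = (frob_norm G)\<^sup>2 + (frob_norm (H - V))\<^sup>2"
    if "V \<in> carrier_mat n n" "transpose_mat V = V" "block_supported c n V" for V
  proof -
    have D: "H - V \<in> carrier_mat n n" using that by (simp add: minus_carrier_mat)
    have "transpose_mat (H - V) = H - V" using that HC Ht by (simp add: transpose_minus)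
    with D have "mat_inner G (H - V) = 0"
      using that HC Hb by (intro G0 block_supported_diff)
    moreover have "M - V = G + (H - V)"
      unfolding G_def using carrier HC that by (intro eq_matI) auto
    ultimately show ?thesis using frob_norm_add_sq[OF GC D] by simp
  qed
  \<comment> \<open>A symmetric involution is an isometry, so its norm is that of the identity;
    hence maximizing \<open><H, V>\<close> on the orbit minimizes \<open>|H - V|\<close>.\<close>
  have nW: "(frob_norm V)\<^sup>2 = real n"
    if "V \<in> carrier_mat n n" "transpose_mat V = V" "V * V = 1\<^sub>m n" for V
  proof -
    have "frob_norm (V * 1\<^sub>m n) = frob_norm (1\<^sub>m n)"
      using that by (intro frob_norm_isometry) auto
    moreover have "(frob_norm (1\<^sub>m n))\<^sup>2 = real n"
    proof -
      have "(frob_norm (1\<^sub>m n))\<^sup>2 = (\<Sum>i<n. \<Sum>j<n. if i = j then 1 else 0)"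
        unfolding frob_norm_sq_eq[OF one_carrier_mat] by (intro sum.cong refl) auto
      then show ?thesis by simp
    qed
    ultimately show ?thesis using that by simp
  qed
  define Z where "Z = H - W"
  have ZC: "Z \<in> carrier_mat n n" using W by (simp add: Z_def minus_carrier_mat)
  have Zt: "transpose_mat Z = Z" using W HC Ht by (simp add: Z_def transpose_minus)
  have Zb: "block_supported c n Z" unfolding Z_def using W HC Hb by (intro block_supported_diff)
  have WZ: "W * Z = Z * W"
    unfolding Z_def using HW W(1) HC
    by (simp add: mult_minus_distrib_mat[of W n n H n W] minus_mult_distrib_mat[of H n n W W n])
  \<comment> \<open>One hypothesis gives two bounds: \<open>|G| <= 1\<close>, which later turns
    \<open>|G|^2\<close> into \<open>|G|\<close>, and \<open>|H - W0| < 1\<close>, which passes to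
    the nearest point \<open>W\<close>.\<close>
  have G1: "(frob_norm G)\<^sup>2 + (frob_norm (H - W0))\<^sup>2 < 1"
  proof -
    have "(frob_norm (M - W0))\<^sup>2 < 1" using U0(3) by (simp add: W0_def abs_square_less_1)
    then show ?thesis using pythagoras[OF W0(1,2,4)] by linarith
  qed
  then have w1: "(frob_norm (H - W0))\<^sup>2 < 1"
    using zero_le_power2[of "frob_norm G"] by linarith
  have "(frob_norm G)\<^sup>2 \<le> 1"
    using G1 zero_le_power2[of "frob_norm (H - W0)"] by linarith
  then have g1: "frob_norm G \<le> 1" by (simp add: abs_square_le_1)
  have "(frob_norm Z)\<^sup>2 \<le> (frob_norm (H - W0))\<^sup>2"
    using max[OF U0(1,2)] nW[OF W(1,2,3)] nW[OF W0(1,2,3)]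
    by (simp add: Z_def frob_norm_diff_sq[OF HC W(1)] frob_norm_diff_sq[OF HC W0(1)] W_def[symmetric] W0_def[symmetric])
  with w1 have "(frob_norm Z)\<^sup>2 < 1" by linarith
  then have Z1: "frob_norm Z < 1" by (simp add: abs_square_less_1)
  have T: "Z * (W * Z) \<in> carrier_mat n n" "transpose_mat (Z * (W * Z)) = Z * (W * Z)"
    "block_supported c n (Z * (W * Z))"
  proof -
    have WZC: "W * Z \<in> carrier_mat n n" using W(1) ZC by simp
    show "Z * (W * Z) \<in> carrier_mat n n" using WZC ZC by simp
    have "transpose_mat (Z * (W * Z)) = (Z * W) * Z"
      using transpose_mult[OF ZC WZC] transpose_mult[OF W(1) ZC] by (simp only: Zt W(2))
    then show "transpose_mat (Z * (W * Z)) = Z * (W * Z)" using assoc_mult_mat[OF ZC W(1) ZC] by simp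
    show "block_supported c n (Z * (W * Z))"
      using W ZC WZC Zb by (intro block_supported_mult)
  qed
  have "M = W + Z + G"
    unfolding G_def Z_def using carrier HC W by (intro eq_matI) auto
  from commuting_part_bound[OF W(1) ZC GC carrier(3) this iso(1) W(2,3) Zt WZ Z1 G0[OF ZC Zt Zb] G0[OF T]]
  have "frob_norm Z \<le> frob_norm C + (frob_norm G)\<^sup>2" .
  also have "(frob_norm G)\<^sup>2 \<le> frob_norm G" using g1 by (simp add: power2_eq_square mult_left_le)
  finally have "(frob_norm Z)\<^sup>2 \<le> (frob_norm C + frob_norm G)\<^sup>2" by (intro power_mono) auto
  also have "\<dots> \<le> 2 * (frob_norm C)\<^sup>2 + 2 * (frob_norm G)\<^sup>2"
    using zero_le_power2[of "frob_norm C - frob_norm G"] by (simp add: power2_eq_square algebra_simps)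
  finally have z: "(frob_norm Z)\<^sup>2 \<le> 2 * (frob_norm C)\<^sup>2 + 2 * (frob_norm G)\<^sup>2" .
  \<comment> \<open>The feedback asks for an orthogonal matrix within distance 1 of
    \<open>M\<close>. \<open>W0\<close> is one, and the resulting bound on \<open>Y - V\<close> does
    not involve it.\<close>
  have "orthogonal_mat n W0" using W0 by (simp add: orthogonal_mat_def)
  from isometry_feedback[OF carrier iso this U0(3)[folded W0_def]]
  obtain V where V: "stiefel m k V" "frob_norm (Y - V) \<le> frob_norm B" by blast
  have "(frob_norm (Y - V))\<^sup>2 \<le> (frob_norm B)\<^sup>2" using V(2) by (intro power_mono) auto
  moreover have "(frob_norm (M - W))\<^sup>2 = (frob_norm G)\<^sup>2 + (frob_norm Z)\<^sup>2"
    using pythagoras[OF W(1,2,4)] by (simp add: Z_def)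
  \<comment> \<open>The coefficient 3 is one \<open>|G|^2\<close> from the Pythagorean split plus
    two from the bound on \<open>|Z|^2\<close>.\<close>
  ultimately have "(frob_norm (M - W))\<^sup>2 + (frob_norm (Y - V))\<^sup>2
      \<le> 3 * (frob_norm G)\<^sup>2 + (frob_norm B)\<^sup>2 + 2 * (frob_norm C)\<^sup>2" using z by linarith
  then show ?thesis using U V(1) unfolding W_def G_def H_def by blast
qed

section \<open>Block form of the isometry and of the residual\<close>

lemma four_block_mat_inj:
  assumes "four_block_mat A B C D = four_block_mat A' B' C' D'"
    and "A \<in> carrier_mat n k" "B \<in> carrier_mat n l" "C \<in> carrier_mat m k" "D \<in> carrier_mat m l"
    and "A' \<in> carrier_mat n k" "B' \<in> carrier_mat n l" "C' \<in> carrier_mat m k" "D' \<in> carrier_mat m l"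
  shows "A = A'" "B = B'" "C = C'" "D = D'"
proof -
  have eq: "four_block_mat A B C D $$ (i, j) = four_block_mat A' B' C' D' $$ (i, j)" for i j
    using assms(1) by simp
  show "A = A'"
  proof (rule eq_matI)
    fix i j assume "i < dim_row A'" "j < dim_col A'"
    then show "A $$ (i, j) = A' $$ (i, j)" using assms(2-) eq[of i j] by auto
  qed (use assms in auto)
  show "B = B'"
  proof (rule eq_matI)
    fix i j assume "i < dim_row B'" "j < dim_col B'"
    then show "B $$ (i, j) = B' $$ (i, j)" using assms(2-) eq[of i "k + j"] by auto
  qed (use assms in auto)
  show "C = C'"
  proof (rule eq_matI)
    fix i j assume "i < dim_row C'" "j < dim_col C'"
    then show "C $$ (i, j) = C' $$ (i, j)" using assms(2-) eq[of "n + i" j] by auto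
  qed (use assms in auto)
  show "D = D'"
  proof (rule eq_matI)
    fix i j assume "i < dim_row D'" "j < dim_col D'"
    then show "D $$ (i, j) = D' $$ (i, j)" using assms(2-) eq[of "n + i" "k + j"] by auto
  qed (use assms in auto)
qed

lemma isometry_four_block:
  fixes M :: "real mat"
  assumes c: "M \<in> carrier_mat n n" "B \<in> carrier_mat n k" "C \<in> carrier_mat m n" "Y \<in> carrier_mat m k"
    and X: "transpose_mat (four_block_mat M B C Y) * four_block_mat M B C Y = 1\<^sub>m (n + k)"
  shows "transpose_mat M * M + transpose_mat C * C = 1\<^sub>m n"
    "transpose_mat M * B + transpose_mat C * Y = 0\<^sub>m n k"
    "transpose_mat B * B + transpose_mat Y * Y = 1\<^sub>m k"
proof -
  have t: "transpose_mat M \<in> carrier_mat n n" "transpose_mat C \<in> carrier_mat n m"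
    "transpose_mat B \<in> carrier_mat k n" "transpose_mat Y \<in> carrier_mat k m"
    using c by auto
  have "four_block_mat (transpose_mat M * M + transpose_mat C * C) (transpose_mat M * B + transpose_mat C * Y)
      (transpose_mat B * M + transpose_mat Y * C) (transpose_mat B * B + transpose_mat Y * Y)
    = four_block_mat (1\<^sub>m n) (0\<^sub>m n k) (0\<^sub>m k n) (1\<^sub>m k)"
    using X unfolding transpose_four_block_mat[OF c] mult_four_block_mat[OF t c] by simp
  from four_block_mat_inj[OF this, of n n k k] c t
  show "transpose_mat M * M + transpose_mat C * C = 1\<^sub>m n"
    "transpose_mat M * B + transpose_mat C * Y = 0\<^sub>m n k"
    "transpose_mat B * B + transpose_mat Y * Y = 1\<^sub>m k"
    by auto
qed

text \<open>\<open>S\<close> lives in the upper left block, so each difference in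
  \<open>stiefel_residual_identity\<close> has a zero lower right block and two off-diagonal blocks
  that are negative transposes of each other. Hence the factor 2 on \<open>|D B|^2\<close> and
  \<open>|C D|^2\<close>.\<close>

lemma residual_four_block:
  assumes c: "M \<in> carrier_mat n n" "B \<in> carrier_mat n k" "C \<in> carrier_mat m n" "Y \<in> carrier_mat m k"
    and D: "D \<in> carrier_mat n n" "transpose_mat D = D"
    and iso: "transpose_mat (four_block_mat M B C Y) * four_block_mat M B C Y = 1\<^sub>m (n + k)"
  defines "X \<equiv> four_block_mat M B C Y" and "S \<equiv> four_block_mat D (0\<^sub>m n k) (0\<^sub>m m n) (0\<^sub>m m k)"
  shows "(frob_norm (transpose_mat M * D - D * M))\<^sup>2 + (frob_norm (D * transpose_mat M - M * D))\<^sup>2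
      + 2 * (frob_norm (D * B))\<^sup>2 + 2 * (frob_norm (C * D))\<^sup>2
    = 2 * (frob_norm (S - X * transpose_mat S * X))\<^sup>2"
proof -
  let ?Mt = "transpose_mat M" and ?Bt = "transpose_mat B" and ?Ct = "transpose_mat C" and ?Yt = "transpose_mat Y"
  have t: "?Mt \<in> carrier_mat n n" "?Ct \<in> carrier_mat n m" "?Bt \<in> carrier_mat k n" "?Yt \<in> carrier_mat k m"
    using c by auto
  have z: "0\<^sub>m n k \<in> carrier_mat n k" "0\<^sub>m m n \<in> carrier_mat m n" "0\<^sub>m m k \<in> carrier_mat m k"
    "0\<^sub>m n m \<in> carrier_mat n m" "0\<^sub>m k n \<in> carrier_mat k n" "0\<^sub>m k m \<in> carrier_mat k m"
    by auto
  have p: "?Mt * D \<in> carrier_mat n n" "D * M \<in> carrier_mat n n" "D * ?Mt \<in> carrier_mat n n"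
    "M * D \<in> carrier_mat n n" "D * B \<in> carrier_mat n k" "?Bt * D \<in> carrier_mat k n"
    "C * D \<in> carrier_mat m n" "D * ?Ct \<in> carrier_mat n m"
    using c t D by auto
  have Xt: "transpose_mat X = four_block_mat ?Mt ?Ct ?Bt ?Yt"
    unfolding X_def by (rule transpose_four_block_mat[OF c])
  have St: "transpose_mat S = four_block_mat D (0\<^sub>m n m) (0\<^sub>m k n) (0\<^sub>m k m)"
    unfolding S_def by (subst transpose_four_block_mat[OF D(1) z(1-3)]) (simp add: D)
  have 1: "transpose_mat X * S = four_block_mat (?Mt * D) (0\<^sub>m n k) (?Bt * D) (0\<^sub>m k k)"
    unfolding Xt unfolding S_def mult_four_block_mat[OF t D(1) z(1-3)] using t p by simp
  have 2: "transpose_mat S * X = four_block_mat (D * M) (D * B) (0\<^sub>m k n) (0\<^sub>m k k)"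
    unfolding St unfolding X_def mult_four_block_mat[OF D(1) z(4-6) c] using c p by simp
  have 3: "S * transpose_mat X = four_block_mat (D * ?Mt) (D * ?Ct) (0\<^sub>m m n) (0\<^sub>m m m)"
    unfolding Xt unfolding S_def mult_four_block_mat[OF D(1) z(1-3) t] using t p by simp
  have 4: "X * transpose_mat S = four_block_mat (M * D) (0\<^sub>m n m) (C * D) (0\<^sub>m m m)"
    unfolding St unfolding X_def mult_four_block_mat[OF c D(1) z(4-6)] using c p by simp
  have z': "0\<^sub>m k k \<in> carrier_mat k k" "0\<^sub>m m m \<in> carrier_mat m m" by auto
  have neg: "frob_norm (0\<^sub>m i j - N) = frob_norm N" "frob_norm (N - 0\<^sub>m i j) = frob_norm N"
    if "N \<in> carrier_mat i j" for N i j
    using that by (auto simp: frob_norm_def)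
  have zz: "frob_norm (0\<^sub>m i j - 0\<^sub>m i j) = 0" for i j by (simp add: frob_norm_def)
  have tr: "frob_norm (?Bt * D) = frob_norm (D * B)" "frob_norm (D * ?Ct) = frob_norm (C * D)"
    using transpose_mult[OF D(1) c(2)] transpose_mult[OF c(3) D(1)] frob_norm_transpose
    unfolding D(2) by metis+
  have 5: "(frob_norm (transpose_mat X * S - transpose_mat S * X))\<^sup>2
      = (frob_norm (?Mt * D - D * M))\<^sup>2 + 2 * (frob_norm (D * B))\<^sup>2"
    unfolding 1 2 diff_four_block_mat[OF p(1) z(1) p(6) z'(1) p(2) p(5) z(5) z'(1)]
    by (subst frob_norm_four_block[of _ n n _ k _ k])
      (use p in \<open>auto simp: neg zz tr minus_carrier_mat\<close>)
  have 6: "(frob_norm (S * transpose_mat X - X * transpose_mat S))\<^sup>2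
      = (frob_norm (D * ?Mt - M * D))\<^sup>2 + 2 * (frob_norm (C * D))\<^sup>2"
    unfolding 3 4 diff_four_block_mat[OF p(3) p(8) z(2) z'(2) p(4) z(4) p(7) z'(2)]
    by (subst frob_norm_four_block[of _ n n _ m _ m])
      (use p in \<open>auto simp: neg zz tr minus_carrier_mat\<close>)
  have "X \<in> carrier_mat (n + m) (n + k)" "S \<in> carrier_mat (n + m) (n + k)"
    using c D z by (auto simp: X_def S_def)
  from stiefel_residual_identity[OF this(1) iso[folded X_def] this(2)] show ?thesis
    unfolding 5 6 by simp
qed

lemma frob_norm_diag_mult_ge:
  assumes B: "B \<in> carrier_mat n k" and m: "0 \<le> m" "\<And>k. k < n \<Longrightarrow> m \<le> c k"
  shows "m\<^sup>2 * (frob_norm B)\<^sup>2 \<le> (frob_norm (diag_mat_of n c * B))\<^sup>2"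
proof -
  have DB: "diag_mat_of n c * B \<in> carrier_mat n k" using diag_mat_of_carrier B by (rule mult_carrier_mat)
  have "m\<^sup>2 * (B $$ (i, j))\<^sup>2 \<le> ((diag_mat_of n c * B) $$ (i, j))\<^sup>2" if "i < n" "j < k" for i j
  proof -
    have "m\<^sup>2 \<le> (c i)\<^sup>2" using m that by (intro power_mono) auto
    then show ?thesis
      unfolding diag_mat_of_mult_index[OF B that] power_mult_distrib by (intro mult_right_mono) auto
  qed
  then show ?thesis
    unfolding frob_norm_sq_eq[OF DB] frob_norm_sq_eq[OF B] sum_distrib_left by (intro sum_mono) auto
qed

lemma frob_norm_mult_diag_ge:
  assumes C: "C \<in> carrier_mat k n" and m: "0 \<le> m" "\<And>k. k < n \<Longrightarrow> m \<le> c k"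
  shows "m\<^sup>2 * (frob_norm C)\<^sup>2 \<le> (frob_norm (C * diag_mat_of n c))\<^sup>2"
proof -
  have "frob_norm (diag_mat_of n c * transpose_mat C) = frob_norm (C * diag_mat_of n c)"
    using transpose_mult[OF C diag_mat_of_carrier] frob_norm_transpose[of "C * diag_mat_of n c"] by simp
  then show ?thesis
    using frob_norm_diag_mult_ge[of "transpose_mat C" n k m c] C m by simp
qed

text \<open>With \<open>g\<close>, \<open>b\<close>, \<open>z\<close> the squared norms of the
  projection defect of \<open>M\<close>, of \<open>B\<close> and of \<open>C\<close>, the squared
  distance is at most \<open>3 g + 2 b + 3 z\<close>; one \<open>b\<close> and one \<open>z\<close>
  arise from comparing \<open>B\<close> and \<open>C\<close> with zero. After weighting by
  \<open>\<alpha>^2\<close>, \<open>b + z\<close> costs at most \<open>\<rho>\<close> and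
  \<open>g\<close> at most \<open>(1 / 2 + 4 * \<iota>) * \<rho>\<close>, which adds up to the
  stated factor.\<close>

lemma error_bound_four_block:
  assumes c: "M \<in> carrier_mat n n" "B \<in> carrier_mat n k" "C \<in> carrier_mat m n" "Y \<in> carrier_mat m k"
    and iso: "transpose_mat (four_block_mat M B C Y) * four_block_mat M B C Y = 1\<^sub>m (n + k)"
    and q: "\<And>k. k < n \<Longrightarrow> q k = 1 \<or> q k = - 1"
    and U0: "orthogonal_mat n U0" "block_supported c n U0" "V0 \<in> carrier_mat m k"
      "frob_norm (four_block_mat M B C Y - four_block_mat (U0 * diag_mat_of n q * transpose_mat U0)
        (0\<^sub>m n k) (0\<^sub>m m n) V0) < 1"
    and \<alpha>: "0 < \<alpha>" "\<And>k. k < n \<Longrightarrow> \<alpha> \<le> c k" and "0 \<le> \<iota>"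
    and gap: "\<And>k l. k < n \<Longrightarrow> l < n \<Longrightarrow> c k \<noteq> c l \<Longrightarrow> 1 \<le> \<iota> * (c k / c l - c l / c k)\<^sup>2"
  defines "X \<equiv> four_block_mat M B C Y"
    and "S \<equiv> four_block_mat (diag_mat_of n c) (0\<^sub>m n k) (0\<^sub>m m n) (0\<^sub>m m k)"
  shows "\<exists>U V. orthogonal_mat n U \<and> block_supported c n U \<and> stiefel m k V \<and>
    \<alpha>\<^sup>2 * (frob_norm (X - four_block_mat (U * diag_mat_of n q * transpose_mat U) (0\<^sub>m n k) (0\<^sub>m m n) V))\<^sup>2
      \<le> (9 / 2 + 12 * \<iota>) * (frob_norm (S - X * transpose_mat S * X))\<^sup>2"
proof -
  have dist: "(frob_norm (X - four_block_mat W (0\<^sub>m n k) (0\<^sub>m m n) V))\<^sup>2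
      = (frob_norm (M - W))\<^sup>2 + (frob_norm B)\<^sup>2 + (frob_norm C)\<^sup>2 + (frob_norm (Y - V))\<^sup>2"
    if "W \<in> carrier_mat n n" "V \<in> carrier_mat m k" for W V
  proof -
    have z: "0\<^sub>m n k \<in> carrier_mat n k" "0\<^sub>m m n \<in> carrier_mat m n" by auto
    have "frob_norm (B - 0\<^sub>m n k) = frob_norm B" "frob_norm (C - 0\<^sub>m m n) = frob_norm C"
      using c by (auto simp: frob_norm_def)
    then show ?thesis
      unfolding X_def diff_four_block_mat[OF c that(1) z that(2)]
      by (subst frob_norm_four_block[of _ n n _ k _ m]) (use c that in \<open>auto simp: minus_carrier_mat\<close>)
  qed
  have WC: "U * diag_mat_of n q * transpose_mat U \<in> carrier_mat n n" if "orthogonal_mat n U" for U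
    using that mult_carrier_mat[OF _ diag_mat_of_carrier, of U n n q] by (auto simp: orthogonal_mat_def)
  \<comment> \<open>Dropping the nonnegative contributions of \<open>B\<close>, \<open>C\<close> and
    \<open>Y - V0\<close> leaves the closeness of the upper left blocks.\<close>
  have "(frob_norm (M - U0 * diag_mat_of n q * transpose_mat U0))\<^sup>2
      \<le> (frob_norm (X - four_block_mat (U0 * diag_mat_of n q * transpose_mat U0) (0\<^sub>m n k) (0\<^sub>m m n) V0))\<^sup>2"
    unfolding dist[OF WC[OF U0(1)] U0(3)] by simp
  then have "frob_norm (M - U0 * diag_mat_of n q * transpose_mat U0)
      \<le> frob_norm (X - four_block_mat (U0 * diag_mat_of n q * transpose_mat U0) (0\<^sub>m n k) (0\<^sub>m m n) V0)"
    by (rule power2_le_imp_le) simp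
  then have near: "frob_norm (M - U0 * diag_mat_of n q * transpose_mat U0) < 1"
    using U0(4) unfolding X_def by linarith
  from stationary_approximation[where q = q, OF c isometry_four_block[OF c iso] q U0(1,2) near]
  obtain U V where UV: "orthogonal_mat n U" "block_supported c n U" "stiefel m k V"
    and le: "(frob_norm (M - U * diag_mat_of n q * transpose_mat U))\<^sup>2 + (frob_norm (Y - V))\<^sup>2
      \<le> 3 * (frob_norm (M - symmetric_block_part c n M))\<^sup>2 + (frob_norm B)\<^sup>2 + 2 * (frob_norm C)\<^sup>2"
    by blast
  have VC: "V \<in> carrier_mat m k" using UV by (simp add: stiefel_def)
  define D where "D = diag_mat_of n c"
  define e where "e = (frob_norm (transpose_mat M * D - D * M))\<^sup>2
    + (frob_norm (D * transpose_mat M - M * D))\<^sup>2"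
  define \<rho> where "\<rho> = (frob_norm (S - X * transpose_mat S * X))\<^sup>2"
  define g b z where "g = (frob_norm (M - symmetric_block_part c n M))\<^sup>2" and "b = (frob_norm B)\<^sup>2"
    and "z = (frob_norm C)\<^sup>2"
  have res: "e + 2 * (frob_norm (D * B))\<^sup>2 + 2 * (frob_norm (C * D))\<^sup>2 = 2 * \<rho>"
    unfolding e_def \<rho>_def S_def X_def D_def
    using residual_four_block[OF c diag_mat_of_carrier transpose_diag_mat_of iso, of c] by simp
  have B: "\<alpha>\<^sup>2 * b \<le> (frob_norm (D * B))\<^sup>2"
    unfolding D_def b_def using \<alpha> by (intro frob_norm_diag_mult_ge[OF c(2)]) auto
  have C: "\<alpha>\<^sup>2 * z \<le> (frob_norm (C * D))\<^sup>2"
    unfolding D_def z_def using \<alpha> by (intro frob_norm_mult_diag_ge[OF c(3)]) auto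
  have g: "\<alpha>\<^sup>2 * g \<le> (1 / 4 + 2 * \<iota>) * e"
    unfolding g_def e_def D_def by (rule off_symmetric_block_part_bound[OF c(1) \<alpha> \<open>0 \<le> \<iota>\<close> gap])
  have "0 \<le> e" by (simp add: e_def)
  \<comment> \<open>\<open>res\<close> is used twice: discarding the \<open>B\<close> and
    \<open>C\<close> terms bounds \<open>e\<close>, and discarding \<open>e\<close> bounds those
    terms.\<close>
  have "e \<le> 2 * \<rho>"
    using res zero_le_power2[of "frob_norm (D * B)"] zero_le_power2[of "frob_norm (C * D)"] by linarith
  then have "(1 / 4 + 2 * \<iota>) * e \<le> (1 / 4 + 2 * \<iota>) * (2 * \<rho>)"
    using \<open>0 \<le> \<iota>\<close> by (intro mult_left_mono) auto
  with g have g': "\<alpha>\<^sup>2 * g \<le> (1 / 4 + 2 * \<iota>) * (2 * \<rho>)" by linarith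
  have bz: "\<alpha>\<^sup>2 * b + \<alpha>\<^sup>2 * z \<le> \<rho>" using B C res \<open>0 \<le> e\<close> by linarith
  have "\<alpha>\<^sup>2 * (frob_norm (X - four_block_mat (U * diag_mat_of n q * transpose_mat U) (0\<^sub>m n k) (0\<^sub>m m n) V))\<^sup>2
      \<le> \<alpha>\<^sup>2 * (3 * g + 2 * b + 3 * z)"
    unfolding dist[OF WC[OF UV(1)] VC] using le by (intro mult_left_mono) (auto simp: g_def b_def z_def)
  also have "\<dots> \<le> 3 * (\<alpha>\<^sup>2 * g) + 3 * (\<alpha>\<^sup>2 * b + \<alpha>\<^sup>2 * z)"
    by (simp add: algebra_simps b_def)
  also have "\<dots> \<le> 3 * ((1 / 4 + 2 * \<iota>) * (2 * \<rho>)) + 3 * \<rho>"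
    using g' bz by (intro add_mono mult_left_mono) auto
  also have "\<dots> = (9 / 2 + 12 * \<iota>) * \<rho>" by (simp add: algebra_simps)
  finally show ?thesis using UV unfolding \<rho>_def by blast
qed

section \<open>Block diagonal structure\<close>

lemma strict_boundaries_mono:
  fixes s :: "nat \<Rightarrow> nat"
  assumes "\<forall>i<p. s i < s (i + 1)" "i \<le> j" "j \<le> p"
  shows "s i \<le> s j"
  using assms(2,3)
proof (induction j rule: dec_induct)
  case (step n)
  then have "s n < s (Suc n)" using assms(1) by simp
  then show ?case using step by simp
qed simp

text \<open>A discrete intermediate value argument: \<open>s\<close> starts at or below
  \<open>k\<close> and ends above it, so some step passes \<open>k\<close>.\<close>

lemma ex_boundary_interval:
  fixes s :: "nat \<Rightarrow> nat"
  assumes "s 0 \<le> k" "k < s p"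
  shows "\<exists>i<p. s i \<le> k \<and> k < s (i + 1)"
  using assms(2)
proof (induction p)
  case (Suc p)
  then show ?case by (cases "k < s p") (auto intro: less_SucI)
qed (use assms in simp)

text \<open>The boundary \<open>s 0\<close> is kept general because the induction removes the first
  block and applies the hypothesis to the shifted sequence \<open>s (Suc i)\<close>, whose
  boundaries start at \<open>s 1\<close>; indices of the tail are then relative to
  \<open>s 1\<close>.\<close>

lemma blkdiag_index:
  assumes "length Us = p" "\<forall>i<p. s i < s (i + 1)"
    and "\<forall>i<p. Us ! i \<in> carrier_mat (s (i + 1) - s i) (s (i + 1) - s i)"
  shows "blkdiag Us \<in> carrier_mat (s p - s 0) (s p - s 0) \<and>
    (\<forall>i k l. i < p \<longrightarrow> s i \<le> k \<longrightarrow> k < s (i + 1) \<longrightarrow> s 0 \<le> l \<longrightarrow> l < s p \<longrightarrow>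
      blkdiag Us $$ (k - s 0, l - s 0)
        = (if s i \<le> l \<and> l < s (i + 1) then (Us ! i) $$ (k - s i, l - s i) else 0))"
  using assms
proof (induction Us arbitrary: p s)
  case (Cons U Us)
  obtain p' where p: "p = Suc p'" "length Us = p'" using Cons.prems(1) by auto
  have "\<forall>i<p'. s (Suc i) < s (Suc (i + 1))"
    "\<forall>i<p'. Us ! i \<in> carrier_mat (s (Suc (i + 1)) - s (Suc i)) (s (Suc (i + 1)) - s (Suc i))"
    using Cons.prems(2,3) p by (auto dest: spec[of _ "Suc _"])
  from Cons.IH[of p' "\<lambda>i. s (Suc i)", OF p(2) this]
  have C: "blkdiag Us \<in> carrier_mat (s p - s 1) (s p - s 1)"
    and E: "\<And>i k l. i < p' \<Longrightarrow> s (Suc i) \<le> k \<Longrightarrow> k < s (Suc (i + 1)) \<Longrightarrow> s 1 \<le> l \<Longrightarrow> l < s p \<Longrightarrow>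
      blkdiag Us $$ (k - s 1, l - s 1)
        = (if s (Suc i) \<le> l \<and> l < s (Suc (i + 1)) then (Us ! i) $$ (k - s (Suc i), l - s (Suc i)) else 0)"
    using p by auto
  have U: "U \<in> carrier_mat (s 1 - s 0) (s 1 - s 0)" using Cons.prems(3) p by auto
  have s01: "s 0 < s 1" using Cons.prems(2) p by auto
  have mono: "s i \<le> s j" if "i \<le> j" "j \<le> p" for i j
    using strict_boundaries_mono[OF Cons.prems(2) that] .
  have s1p: "s 1 \<le> s p" using p by (intro mono) auto
  let ?F = "blkdiag (U # Us)"
  have FC: "?F \<in> carrier_mat (s p - s 0) (s p - s 0)"
  proof -
    have "?F \<in> carrier_mat ((s 1 - s 0) + (s p - s 1)) ((s 1 - s 0) + (s p - s 1))"
      using U C by simp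
    moreover have "(s 1 - s 0) + (s p - s 1) = s p - s 0" using s01 s1p by simp
    ultimately show ?thesis by simp
  qed
  have F: "?F $$ (x, y) = (if x < s 1 - s 0 then if y < s 1 - s 0 then U $$ (x, y) else 0
      else if y < s 1 - s 0 then 0 else blkdiag Us $$ (x - (s 1 - s 0), y - (s 1 - s 0)))"
    if "x < s p - s 0" "y < s p - s 0" for x y
  proof -
    have "x < s 1 - s 0 + (s p - s 1)" "y < s 1 - s 0 + (s p - s 1)" using that s01 s1p by simp_all
    moreover have "x - (s 1 - s 0) < s p - s 1" if "\<not> x < s 1 - s 0"
      using that \<open>x < s 1 - s 0 + (s p - s 1)\<close> by linarith
    moreover have "y - (s 1 - s 0) < s p - s 1" if "\<not> y < s 1 - s 0"
      using that \<open>y < s 1 - s 0 + (s p - s 1)\<close> by linarith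
    ultimately show ?thesis
      using carrier_matD[OF U] carrier_matD[OF C] by simp
  qed
  have "?F $$ (k - s 0, l - s 0) = (if s i \<le> l \<and> l < s (i + 1) then ((U # Us) ! i) $$ (k - s i, l - s i) else 0)"
    if ikl: "i < p" "s i \<le> k" "k < s (i + 1)" "s 0 \<le> l" "l < s p" for i k l
  proof (cases i)
    case 0
    then have "k - s 0 < s 1 - s 0" "k - s 0 < s p - s 0" "l - s 0 < s p - s 0"
      "l - s 0 < s 1 - s 0 \<longleftrightarrow> l < s 1"
      using s01 s1p ikl by auto
    with 0 show ?thesis using ikl by (simp add: F del: blkdiag.simps)
  next
    case (Suc i')
    have "s 1 \<le> s i" using Suc ikl by (intro mono) auto
    moreover have "s (i + 1) \<le> s p" using ikl by (intro mono) auto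
    ultimately have k: "s 1 \<le> k" "k < s p" using ikl by auto
    have b: "k - s 0 < s p - s 0" "l - s 0 < s p - s 0" "\<not> k - s 0 < s 1 - s 0"
      "l - s 0 < s 1 - s 0 \<longleftrightarrow> l < s 1"
      using s01 s1p ikl k by auto
    show ?thesis
    proof (cases "l < s 1")
      case True
      then have "\<not> s i \<le> l" using \<open>s 1 \<le> s i\<close> by simp
      then show ?thesis using True b by (simp add: F del: blkdiag.simps)
    next
      case False
      have "k - s 0 - (s 1 - s 0) = k - s 1" "l - s 0 - (s 1 - s 0) = l - s 1"
        using s01 k False by auto
      then have "?F $$ (k - s 0, l - s 0) = blkdiag Us $$ (k - s 1, l - s 1)"
        using False b by (simp add: F del: blkdiag.simps)
      also have "\<dots> = (if s i \<le> l \<and> l < s (i + 1) then (Us ! i') $$ (k - s i, l - s i) else 0)"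
        using E[of i' k l] ikl p False Suc by auto
      finally show ?thesis using Suc by simp
    qed
  qed
  with FC show ?case by blast
qed simp

lemma orthogonal_four_block:
  assumes U: "orthogonal_mat n U" and V: "orthogonal_mat m V"
  shows "orthogonal_mat (n + m) (four_block_mat U (0\<^sub>m n m) (0\<^sub>m m n) V)"
proof -
  have c: "U \<in> carrier_mat n n" "0\<^sub>m n m \<in> carrier_mat n m" "0\<^sub>m m n \<in> carrier_mat m n" "V \<in> carrier_mat m m"
    and t: "transpose_mat U \<in> carrier_mat n n" "transpose_mat V \<in> carrier_mat m m"
    using U V by (auto simp: orthogonal_mat_def)
  show ?thesis
    unfolding orthogonal_mat_def transpose_four_block_mat[OF c]
    using U V c t by (subst mult_four_block_mat[of _ n n _ m _ m _ _ n _ m]) (auto simp: orthogonal_mat_def)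
qed

text \<open>The size is left existential to spare adding up block sizes; it is recovered afterwards
  from the carrier of \<open>blkdiag Us\<close>.\<close>

lemma orthogonal_blkdiag:
  "\<forall>U\<in>set Us. \<exists>n. orthogonal_mat n U \<Longrightarrow> \<exists>n. orthogonal_mat n (blkdiag Us)"
proof (induction Us)
  case (Cons U Us)
  then obtain n m where U: "orthogonal_mat n U" and V: "orthogonal_mat m (blkdiag Us)" by auto
  then have "dim_row U = n" "dim_col U = n" "dim_row (blkdiag Us) = m" "dim_col (blkdiag Us) = m"
    by (auto simp: orthogonal_mat_def)
  then show ?case using orthogonal_four_block[OF U V] by auto
qed (auto simp: orthogonal_mat_def intro!: exI[of _ 0])

text \<open>Since \<open>c\<close> has the constant value \<open>e i\<close> on the
  \<open>i\<close>-th interval and \<open>e\<close> is injective, the level sets of \<open>c\<close>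
  are exactly the intervals. This translates between lists of blocks and
  \<open>block_supported\<close>.\<close>

lemma blkdiag_orthogonal_iff:
  assumes s: "s 0 = 0" "\<forall>i<p. s i < s (i + 1)" "s p = r"
    and c: "\<And>i k. i < p \<Longrightarrow> s i \<le> k \<Longrightarrow> k < s (i + 1) \<Longrightarrow> c k = e i" "inj_on e {..<p}"
  shows "(\<exists>Us. length Us = p \<and> (\<forall>i<p. orthogonal_mat (s (i + 1) - s i) (Us ! i)) \<and> U = blkdiag Us)
    \<longleftrightarrow> orthogonal_mat r U \<and> block_supported c r U"
proof
  assume "\<exists>Us. length Us = p \<and> (\<forall>i<p. orthogonal_mat (s (i + 1) - s i) (Us ! i)) \<and> U = blkdiag Us"
  then obtain Us where Us: "length Us = p" "\<forall>i<p. orthogonal_mat (s (i + 1) - s i) (Us ! i)"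
    and U: "U = blkdiag Us" by blast
  have "\<forall>i<p. Us ! i \<in> carrier_mat (s (i + 1) - s i) (s (i + 1) - s i)"
    using Us by (auto simp: orthogonal_mat_def)
  note B = blkdiag_index[OF Us(1) s(2) this]
  have UC: "U \<in> carrier_mat r r" using B s U by simp
  obtain n where n: "orthogonal_mat n U"
    using orthogonal_blkdiag[of Us] Us U by (metis in_set_conv_nth)
  then have "n = r" using UC by (auto simp: orthogonal_mat_def)
  moreover have "block_supported c r U"
    unfolding block_supported_def
  proof (intro allI impI)
    fix k l assume kl: "k < r" "l < r" "c k \<noteq> c l"
    obtain i where i: "i < p" "s i \<le> k" "k < s (i + 1)" using ex_boundary_interval[of s k p] kl s by auto
    have "\<not> (s i \<le> l \<and> l < s (i + 1))" using c(1)[OF i(1)] i kl(3) by metis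
    then show "U $$ (k, l) = 0" using B i kl s U by auto
  qed
  ultimately show "orthogonal_mat r U \<and> block_supported c r U" using n by simp
next
  assume A: "orthogonal_mat r U \<and> block_supported c r U"
  then have UC: "U \<in> carrier_mat r r" by (simp add: orthogonal_mat_def)
  \<comment> \<open>The list is recovered by cutting the diagonal blocks out of
    \<open>U\<close>.\<close>
  define Us where "Us = map (\<lambda>i. mat (s (i + 1) - s i) (s (i + 1) - s i) (\<lambda>(x, y). U $$ (s i + x, s i + y))) [0..<p]"
  have Us: "length Us = p"
    "Us ! i = mat (s (i + 1) - s i) (s (i + 1) - s i) (\<lambda>(x, y). U $$ (s i + x, s i + y))" if "i < p" for i
    using that by (auto simp: Us_def)
  have len: "length Us = p" by (simp add: Us_def)
  have "\<forall>i<p. Us ! i \<in> carrier_mat (s (i + 1) - s i) (s (i + 1) - s i)" using Us by auto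
  note B = blkdiag_index[OF len s(2) this]
  have zero: "U $$ (k, l) = 0"
    if ikl: "i < p" "s i \<le> k" "k < s (i + 1)" "l < r" "\<not> (s i \<le> l \<and> l < s (i + 1))" "k < r" for i k l
  proof -
    obtain j where j: "j < p" "s j \<le> l" "l < s (j + 1)" using ex_boundary_interval[of s l p] ikl(4) s by auto
    have "j \<noteq> i" using j ikl by auto
    then have "c k \<noteq> c l" using c(1)[OF ikl(1-3)] c(1)[OF j] c(2) j(1) ikl(1) by (auto simp: inj_on_def)
    then show ?thesis using A ikl by (auto simp: block_supported_def)
  qed
  have sp: "s (i + 1) \<le> r" if "i < p" for i
    using strict_boundaries_mono[OF s(2), of "i + 1" p] that s by simp
  have "blkdiag Us = U"
  proof (rule eq_matI)
    fix k l assume "k < dim_row U" "l < dim_col U"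
    then have kl: "k < r" "l < r" using UC by auto
    obtain i where i: "i < p" "s i \<le> k" "k < s (i + 1)" using ex_boundary_interval[of s k p] kl s by auto
    have "blkdiag Us $$ (k, l) = (if s i \<le> l \<and> l < s (i + 1) then (Us ! i) $$ (k - s i, l - s i) else 0)"
      using B i kl s by auto
    also have "\<dots> = U $$ (k, l)" using zero[OF i kl(2) _ kl(1)] i Us(2)[OF i(1)] by auto
    finally show "blkdiag Us $$ (k, l) = U $$ (k, l)" .
  qed (use B s UC in auto)
  moreover have "orthogonal_mat (s (i + 1) - s i) (Us ! i)" if i: "i < p" for i
    unfolding orthogonal_columns
  proof (intro conjI allI impI)
    show "Us ! i \<in> carrier_mat (s (i + 1) - s i) (s (i + 1) - s i)" using Us i by auto
    fix x y assume xy: "x < s (i + 1) - s i" "y < s (i + 1) - s i"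
    let ?h = "\<lambda>a. U $$ (a, s i + x) * U $$ (a, s i + y)"
    have bounds: "s i + x < r" "s i + y < r" using xy sp[OF i] by auto
    have "(\<Sum>a<s (i + 1) - s i. (Us ! i) $$ (a, x) * (Us ! i) $$ (a, y)) = (\<Sum>a<s (i + 1) - s i. ?h (s i + a))"
      using xy by (intro sum.cong) (auto simp: Us(2)[OF i])
    also have "\<dots> = (\<Sum>a\<in>{s i..<s (i + 1)}. ?h a)"
      using s(2) i by (intro sum.reindex_bij_witness[of _ "\<lambda>a. a - s i" "\<lambda>a. s i + a"]) auto
    \<comment> \<open>A column through block \<open>i\<close> vanishes outside the rows of that
      block, so the sum may run over all rows, where orthogonality of \<open>U\<close>
      applies.\<close>
    also have "\<dots> = (\<Sum>a<r. ?h a)"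
    proof (intro sum.mono_neutral_left ballI)
      fix a assume a: "a \<in> {..<r} - {s i..<s (i + 1)}"
      obtain j where j: "j < p" "s j \<le> a" "a < s (j + 1)" using ex_boundary_interval[of s a p] a s by auto
      have "j \<noteq> i" using j a by auto
      have "c (s i + x) = e i" using xy i by (intro c(1)) auto
      moreover have "c a = e j" using j by (intro c(1)) auto
      ultimately have "c a \<noteq> c (s i + x)" using \<open>j \<noteq> i\<close> c(2) i j(1) by (auto simp: inj_on_def)
      then show "?h a = 0" using A a bounds by (auto simp: block_supported_def)
    qed (use sp[OF i] in auto)
    also have "\<dots> = (if x = y then 1 else 0)"
      using A bounds by (auto simp: orthogonal_columns)
    finally show "(\<Sum>a<s (i + 1) - s i. (Us ! i) $$ (a, x) * (Us ! i) $$ (a, y)) = (if x = y then 1 else 0)" .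
  qed
  ultimately show "\<exists>Us. length Us = p \<and> (\<forall>i<p. orthogonal_mat (s (i + 1) - s i) (Us ! i)) \<and> U = blkdiag Us"
    using len by blast
qed

lemma Qset_eq:
  assumes "s 0 = 0" "\<forall>i<p. s i < s (i + 1)" "s p = r"
    and "\<And>i k. i < p \<Longrightarrow> s i \<le> k \<Longrightarrow> k < s (i + 1) \<Longrightarrow> c k = e i" "inj_on e {..<p}"
  shows "Qset d K r p s q =
    {four_block_mat (U * diag_mat_of r q * transpose_mat U) (0\<^sub>m r (K - r)) (0\<^sub>m (d - r) r) V
      | U V. orthogonal_mat r U \<and> block_supported c r U \<and> stiefel (d - r) (K - r) V}"
  unfolding Qset_def using blkdiag_orthogonal_iff[OF assms] by auto

text \<open>The first \<open>k\<close> columns of the identity witness that the target set is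
  nonempty, without which an infimum of distances would say nothing.\<close>

lemma stiefel_nonempty:
  assumes "k \<le> m"
  shows "stiefel m k (mat m k (\<lambda>(i, j). if i = j then 1 else 0))" (is "stiefel m k ?V")
proof -
  have "transpose_mat ?V * ?V = 1\<^sub>m k"
  proof (rule eq_matI)
    fix i j assume "i < dim_row (1\<^sub>m k :: real mat)" "j < dim_col (1\<^sub>m k :: real mat)"
    then have ij: "i < k" "j < k" by auto
    have "(transpose_mat ?V * ?V) $$ (i, j) = (\<Sum>l<m. transpose_mat ?V $$ (i, l) * ?V $$ (l, j))"
      using ij by (intro index_mult_mat_sum[of _ k m _ k]) auto
    also have "\<dots> = (\<Sum>l<m. if l = i then (if i = j then 1 else 0) else 0)"
      using ij by (intro sum.cong refl) auto
    finally show "(transpose_mat ?V * ?V) $$ (i, j) = 1\<^sub>m k $$ (i, j)" using ij assms by simp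
  qed auto
  then show ?thesis by (simp add: stiefel_def)
qed

section \<open>The error bound\<close>

text \<open>Trades the minimum inside \<open>kappa\<close> for one inequality per pair of blocks.
  For \<open>p <= 1\<close> the value is 0 by convention and there are no pairs.\<close>

lemma inv_min_delta_sq_bounds:
  assumes pos: "\<And>i. i \<in> {1..p} \<Longrightarrow> 0 < a (s i)" and inj: "inj_on (\<lambda>i. a (s i)) {1..p}"
  shows "0 \<le> inv_min_delta_sq a s p"
    and "\<And>i j. i \<in> {1..p} \<Longrightarrow> j \<in> {1..p} \<Longrightarrow> i \<noteq> j \<Longrightarrow>
      1 \<le> inv_min_delta_sq a s p * (delta_gap a s i j)\<^sup>2"
proof -
  define \<Delta> where "\<Delta> = {(delta_gap a s i j)\<^sup>2 | i j. i \<in> {1..p} \<and> j \<in> {1..p} \<and> i \<noteq> j}"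
  have "\<Delta> \<subseteq> (\<lambda>(i, j). (delta_gap a s i j)\<^sup>2) ` ({1..p} \<times> {1..p})" by (auto simp: \<Delta>_def)
  then have fin: "finite \<Delta>" by (rule finite_subset) simp
  have gap: "0 < (delta_gap a s i j)\<^sup>2" if "i \<in> {1..p}" "j \<in> {1..p}" "i \<noteq> j" for i j
  proof -
    have p: "0 < a (s i)" "0 < a (s j)" using pos that by auto
    have "a (s i) \<noteq> a (s j)" using inj_onD[OF inj _ that(1,2)] that(3) by blast
    \<comment> \<open>\<open>delta_gap\<close> is the difference of squares over the product of the
      two values, and squaring is injective on positive reals.\<close>
    then have "a (s i) * a (s i) \<noteq> a (s j) * a (s j)"
      using p power2_eq_imp_eq[of "a (s i)" "a (s j)"] by (metis less_imp_le power2_eq_square)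
    then have "(a (s i) * a (s i) - a (s j) * a (s j)) / (a (s j) * a (s i)) \<noteq> 0"
      using p by simp
    moreover have "delta_gap a s i j
        = (a (s i) * a (s i) - a (s j) * a (s j)) / (a (s j) * a (s i))"
      unfolding delta_gap_def using p by (intro diff_frac_eq) auto
    ultimately have "delta_gap a s i j \<noteq> 0" by simp
    then show ?thesis by simp
  qed
  have Min: "0 < Min \<Delta>" if "1 < p"
  proof -
    \<comment> \<open>The first two blocks show that the set is nonempty, so its minimum is attained
      and inherits positivity.\<close>
    have "(delta_gap a s 1 2)\<^sup>2 \<in> \<Delta>" using that by (force simp: \<Delta>_def)
    then have "Min \<Delta> \<in> \<Delta>" using fin by (intro Min_in) auto
    then show ?thesis using gap by (auto simp: \<Delta>_def)
  qed
  have inv: "inv_min_delta_sq a s p = (if p \<le> 1 then 0 else 1 / Min \<Delta>)"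
    unfolding inv_min_delta_sq_def \<Delta>_def ..
  show "0 \<le> inv_min_delta_sq a s p"
    using Min unfolding inv by (auto intro: less_imp_le)
  show "1 \<le> inv_min_delta_sq a s p * (delta_gap a s i j)\<^sup>2"
    if "i \<in> {1..p}" "j \<in> {1..p}" "i \<noteq> j" for i j
  proof -
    have p: "1 < p" using that by auto
    have "Min \<Delta> \<le> (delta_gap a s i j)\<^sup>2" using fin that by (intro Min_le) (auto simp: \<Delta>_def)
    then show ?thesis using p Min unfolding inv by simp
  qed
qed

lemma frob_norm_orthogonal_conj:
  assumes U: "orthogonal_mat d U" and V: "orthogonal_mat k V" and P: "P \<in> carrier_mat d k"
  shows "frob_norm (U * P * transpose_mat V) = frob_norm P"
  using frob_norm_isometry_right[of V k k "U * P" d] frob_norm_isometry[of U d d P k] assms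
  by (auto simp: orthogonal_mat_def)

lemma orthogonal_conj_diff:
  fixes U V :: "real mat"
  assumes U: "U \<in> carrier_mat d d" and V: "V \<in> carrier_mat k k"
    and P: "P \<in> carrier_mat d k" "P' \<in> carrier_mat d k"
  shows "U * P * transpose_mat V - U * P' * transpose_mat V = U * (P - P') * transpose_mat V"
proof -
  have Vt: "transpose_mat V \<in> carrier_mat k k" using V by simp
  show ?thesis
    unfolding mult_minus_distrib_mat[OF U P]
      minus_mult_distrib_mat[OF mult_carrier_mat[OF U P(1)] mult_carrier_mat[OF U P(2)] Vt] ..
qed

text \<open>\<open>9 / 2 <= 13\<close>, and \<open>12 <= 6 * (6 * p - 5)\<close> for
  \<open>p >= 2\<close>, so the constant obtained is below that of \<open>kappa\<close>. For
  \<open>p = 1\<close> the second factor is only 6, but there \<open>inv_min_delta_sq\<close> is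
  0.\<close>

lemma kappa_bound:
  assumes "0 < a r" "0 \<le> inv_min_delta_sq a s p" "1 \<le> p" "0 \<le> x" "0 \<le> y"
    and le: "(a r)\<^sup>2 * x\<^sup>2 \<le> (9 / 2 + 12 * inv_min_delta_sq a s p) * y\<^sup>2"
  shows "x \<le> kappa a s p r * y"
proof -
  let ?\<iota> = "inv_min_delta_sq a s p"
  define w where "w = 13 + 6 * (6 * real p - 5) * ?\<iota>"
  have "12 * ?\<iota> \<le> 6 * (6 * real p - 5) * ?\<iota>"
  proof (cases "p = 1")
    case False
    then have "12 \<le> 6 * (6 * real p - 5)" using assms(3) by simp
    then show ?thesis using assms(2) by (intro mult_right_mono) auto
  qed (simp add: inv_min_delta_sq_def)
  then have w: "9 / 2 + 12 * ?\<iota> \<le> w" unfolding w_def by linarith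
  then have "0 \<le> w" using assms(2) by linarith
  have "(a r * x)\<^sup>2 \<le> w * y\<^sup>2"
    using le mult_right_mono[OF w, of "y\<^sup>2"] by (simp add: power_mult_distrib)
  also have "\<dots> = (sqrt w * y)\<^sup>2" using \<open>0 \<le> w\<close> by (simp add: power_mult_distrib)
  finally have "a r * x \<le> sqrt w * y" using \<open>0 \<le> w\<close> assms(5) by (auto dest: power2_le_imp_le)
  then have "x * a r \<le> sqrt w * y" by (simp only: mult.commute)
  then have "x \<le> sqrt w * y / a r" by (simp only: pos_le_divide_eq[OF assms(1)])
  also have "\<dots> = kappa a s p r * y"
    by (simp only: kappa_def w_def times_divide_eq_left mult_1_left)
  finally show ?thesis .
qed

theorem theorem4:
  fixes d K r p :: nat and A UA VA :: "real mat" and a :: "nat \<Rightarrow> real" and s :: "nat \<Rightarrow> nat"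
  assumes "1 \<le> r" "r \<le> K" "K \<le> d"
    and "A \<in> carrier_mat d K"
    and "orthogonal_mat d UA" "orthogonal_mat K VA"
    and "A = UA * mat d K (\<lambda>(i, j). if i = j \<and> i < r then a (i + 1) else 0) * transpose_mat VA"
    and "\<forall>i\<in>{1..<r}. a i \<ge> a (i + 1)" "a r > 0"
    and "s 0 = 0" "\<forall>i<p. s i < s (i + 1)" "s p = r"
    and "\<forall>i\<in>{1..p}. \<forall>k\<in>{s (i - 1) + 1..s i}. a k = a (s i)"
    and "\<forall>i\<in>{1..<p}. a (s i) > a (s (i + 1))"
  shows "\<forall>q :: nat \<Rightarrow> real. (\<forall>i<r. q i = 1 \<or> q i = -1) \<longrightarrow>
           (\<forall>Q. stiefel d K Q \<and> dist_set Q (Qbar UA VA d K r p s q) < 1 \<longrightarrow>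
              dist_set Q (Qbar UA VA d K r p s q)
                \<le> kappa a s p r * frob_norm (A - Q * transpose_mat A * Q))"
proof (intro allI impI, elim conjE)
  fix q :: "nat \<Rightarrow> real" and Q
  assume q: "\<forall>i<r. q i = 1 \<or> q i = -1" and Q: "stiefel d K Q"
    and near: "dist_set Q (Qbar UA VA d K r p s q) < 1"
  \<comment> \<open>Singular values are numbered from 1, matrix indices from 0: \<open>c\<close> is
    the shifted sequence, and \<open>e i\<close> is its value on the rows from \<open>s i\<close> to
    \<open>s (i + 1) - 1\<close>.\<close>
  define c where "c k = a (k + 1)" for k
  define e where "e i = a (s (i + 1))" for i
  define k m where "k = K - r" and "m = d - r"
  have Kd: "K = r + k" "d = r + m" and km: "k \<le> m" using assms(2,3) by (auto simp: k_def m_def)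
  have "1 \<le> p" using assms(1,10,12) by (cases p) auto
  have ce: "c l = e i" if "i < p" "s i \<le> l" "l < s (i + 1)" for i l
    using assms(13)[rule_format, of "i + 1" "l + 1"] that by (simp add: c_def e_def)
  have step: "e (Suc i) < e i" if "Suc i < p" for i
    using assms(14) that by (simp add: e_def)
  have e_less: "e j < e i" if "i < j" "j < p" for i j
    using that
  proof (induction j)
    case (Suc j)
    then show ?case using step[of j] by (cases "i = j") auto
  qed simp
  have inj: "inj_on e {..<p}"
  proof (rule inj_onI)
    fix i j assume "i \<in> {..<p}" "j \<in> {..<p}" "e i = e j"
    then show "i = j" using e_less[of i j] e_less[of j i] by (cases i j rule: linorder_cases) auto
  qed
  \<comment> \<open>Descending induction from \<open>r\<close>: the last singular value bounds the
    others from below and so can serve as \<open>\<alpha>\<close>.\<close>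
  have car: "a r \<le> a l" if "1 \<le> l" "l \<le> r" for l
    using that(2,1)
  proof (induction l rule: inc_induct)
    case (step l)
    then have "a l \<ge> a (l + 1)" using assms(8) by simp
    then show ?case using step by simp
  qed simp
  have c_ge: "a r \<le> c l" if "l < r" for l using car[of "l + 1"] that by (simp add: c_def)
  have s_range: "1 \<le> s i \<and> s i \<le> r" if "i \<in> {1..p}" for i
  proof -
    have "s 0 < s 1" using assms(11) that by auto
    then show ?thesis
      using that strict_boundaries_mono[OF assms(11), of 1 i] strict_boundaries_mono[OF assms(11), of i p]
        assms(12) by auto
  qed
  have pos: "0 < a (s i)" if "i \<in> {1..p}" for i
    using car[of "s i"] s_range[OF that] assms(9) by linarith
  have inj': "inj_on (\<lambda>i. a (s i)) {1..p}"
  proof (rule inj_onI)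
    fix i j assume "i \<in> {1..p}" "j \<in> {1..p}" "a (s i) = a (s j)"
    \<comment> \<open>Blocks are numbered from 1 in \<open>delta_gap\<close> and from 0 in
      \<open>e\<close>, so injectivity is transferred through \<open>i - 1\<close>.\<close>
    moreover from this have "i - 1 = j - 1" by (intro inj_onD[OF inj]) (auto simp: e_def)
    ultimately show "i = j" by auto
  qed
  define \<iota> where "\<iota> = inv_min_delta_sq a s p"
  note \<iota> = inv_min_delta_sq_bounds[of p a s, OF pos inj', folded \<iota>_def]
  have gap: "1 \<le> \<iota> * (c x / c y - c y / c x)\<^sup>2" if xy: "x < r" "y < r" "c x \<noteq> c y" for x y
  proof -
    obtain i where i: "i < p" "s i \<le> x" "x < s (i + 1)"
      using ex_boundary_interval[of s x p] assms(10,12) xy by auto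
    obtain j where j: "j < p" "s j \<le> y" "y < s (j + 1)"
      using ex_boundary_interval[of s y p] assms(10,12) xy by auto
    have "i \<noteq> j" using xy(3) ce[OF i] ce[OF j] by auto
    then have "1 \<le> \<iota> * (delta_gap a s (i + 1) (j + 1))\<^sup>2" using i j by (intro \<iota>) auto
    then show ?thesis unfolding ce[OF i] ce[OF j] by (simp add: delta_gap_def e_def)
  qed

  have UA: "UA \<in> carrier_mat d d" "transpose_mat UA \<in> carrier_mat d d" "transpose_mat UA * UA = 1\<^sub>m d"
    and VA: "VA \<in> carrier_mat K K" "transpose_mat VA \<in> carrier_mat K K" "transpose_mat VA * VA = 1\<^sub>m K"
    and QC: "Q \<in> carrier_mat d K" "transpose_mat Q * Q = 1\<^sub>m K"
    using assms(5,6) Q by (auto simp: orthogonal_mat_def stiefel_def)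
  \<comment> \<open>In the coordinates of the singular vectors, \<open>A\<close> becomes
    \<open>S\<close> and \<open>Q\<close> becomes \<open>X\<close>, again an isometry; the norms of
    residual and distance are unchanged.\<close>
  define X where "X = transpose_mat UA * Q * VA"
  define S where "S = mat d K (\<lambda>(i, j). if i = j \<and> i < r then c i else 0)"
  have XC: "X \<in> carrier_mat d K" and SC: "S \<in> carrier_mat d K" "transpose_mat S \<in> carrier_mat K d"
    using UA VA QC by (auto simp: X_def S_def)
  have A: "A = UA * S * transpose_mat VA" unfolding S_def c_def by (rule assms(7))
  have UX: "UA * X = Q * VA"
  proof -
    have "UA * X = UA * transpose_mat UA * (Q * VA)"
      unfolding X_def using UA(1,2) VA(1) QC(1)
      by (simp add: assoc_mult_mat[of _ d d _ d _ K] assoc_mult_mat[of _ d d _ K _ K])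
    also have "\<dots> = Q * VA"
      unfolding orthogonal_mat_transpose[OF assms(5)]
      by (rule left_mult_one_mat[OF mult_carrier_mat[OF QC(1) VA(1)]])
    finally show ?thesis .
  qed
  have QX: "UA * X * transpose_mat VA = Q"
    unfolding UX using orthogonal_mat_transpose[OF assms(6)] QC(1) VA(1,2)
    by (simp add: assoc_mult_mat[of _ d K _ K _ K])
  have XtX: "transpose_mat X * X = 1\<^sub>m K"
  proof -
    have t: "transpose_mat X = transpose_mat VA * (transpose_mat Q * UA)"
      unfolding X_def transpose_mult[OF mult_carrier_mat[OF UA(2) QC(1)] VA(1)]
        transpose_mult[OF UA(2) QC(1)] by simp
    have "(transpose_mat Q * UA) * X = transpose_mat Q * (Q * VA)"
      using assoc_mult_mat[of "transpose_mat Q" K d UA d X K] QC(1) UA(1) XC by (simp add: UX)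
    also have "\<dots> = VA"
      using assoc_mult_mat[of "transpose_mat Q" K d Q K VA K] QC VA(1) by simp
    finally show ?thesis
      unfolding t using assoc_mult_mat[of "transpose_mat VA" K K "transpose_mat Q * UA" d X K]
        UA(1) VA QC(1) XC by simp
  qed
  have residual: "frob_norm (A - Q * transpose_mat A * Q) = frob_norm (S - X * transpose_mat S * X)"
  proof -
    have At: "transpose_mat A = VA * (transpose_mat S * transpose_mat UA)"
      unfolding A transpose_mult[OF mult_carrier_mat[OF UA(1) SC(1)] VA(2)] transpose_mult[OF UA(1) SC(1)] by simp
    have SU: "transpose_mat S * transpose_mat UA \<in> carrier_mat K d" using SC UA by simp
    have UQ: "transpose_mat UA * Q = X * transpose_mat VA"
      unfolding X_def assoc_mult_mat[OF mult_carrier_mat[OF UA(2) QC(1)] VA(1,2)]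
        orthogonal_mat_transpose[OF assms(6)]
      by (rule right_mult_one_mat[OF mult_carrier_mat[OF UA(2) QC(1)], symmetric])
    have "Q * transpose_mat A * Q = (Q * VA) * (transpose_mat S * transpose_mat UA) * Q"
      unfolding At using assoc_mult_mat[OF QC(1) VA(1) SU] by simp
    also have "\<dots> = UA * X * (transpose_mat S * (transpose_mat UA * Q))"
      unfolding UX[symmetric] using UA(1,2) XC SC(2) SU QC(1)
      by (simp add: assoc_mult_mat[of _ d K _ d _ K] assoc_mult_mat[of _ K d _ d _ K])
    also have "\<dots> = UA * (X * transpose_mat S * X) * transpose_mat VA"
    proof -
      have n: "UA * X \<in> carrier_mat d K" "X * transpose_mat VA \<in> carrier_mat d K"
        "transpose_mat S * X \<in> carrier_mat K K" "X * transpose_mat S \<in> carrier_mat d d"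
        "X * (transpose_mat S * X) \<in> carrier_mat d K"
        using UA(1) XC SC(2) VA(2) by auto
      have "UA * X * (transpose_mat S * (X * transpose_mat VA)) = UA * X * ((transpose_mat S * X) * transpose_mat VA)"
        using assoc_mult_mat[OF SC(2) XC VA(2)] by simp
      also have "\<dots> = (UA * X * (transpose_mat S * X)) * transpose_mat VA"
        using assoc_mult_mat[OF n(1) n(3) VA(2)] by simp
      also have "UA * X * (transpose_mat S * X) = UA * (X * transpose_mat S * X)"
        using assoc_mult_mat[OF UA(1) XC n(3)] assoc_mult_mat[OF XC SC(2) XC] by simp
      finally show ?thesis unfolding UQ .
    qed
    finally have "A - Q * transpose_mat A * Q = UA * (S - X * transpose_mat S * X) * transpose_mat VA"
      using orthogonal_conj_diff[OF UA(1) VA(1) SC(1), of "X * transpose_mat S * X"] XC SC(2) A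
      by (metis mult_carrier_mat)
    moreover have "S - X * transpose_mat S * X \<in> carrier_mat d K"
      using mult_carrier_mat[OF mult_carrier_mat[OF XC SC(2)] XC] by (rule minus_carrier_mat)
    ultimately show ?thesis using frob_norm_orthogonal_conj[OF assms(5,6)] by simp
  qed
  have dist: "frob_norm (Q - UA * W * transpose_mat VA) = frob_norm (X - W)" if W: "W \<in> carrier_mat d K" for W
    using orthogonal_conj_diff[OF UA(1) VA(1) XC W] QX
      frob_norm_orthogonal_conj[OF assms(5,6) minus_carrier_mat[OF W, of X]] by simp

  define M B C Y where "M = mat r r (\<lambda>(i, j). X $$ (i, j))" and "B = mat r k (\<lambda>(i, j). X $$ (i, j + r))"
    and "C = mat m r (\<lambda>(i, j). X $$ (i + r, j))" and "Y = mat m k (\<lambda>(i, j). X $$ (i + r, j + r))"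
  have bc: "M \<in> carrier_mat r r" "B \<in> carrier_mat r k" "C \<in> carrier_mat m r" "Y \<in> carrier_mat m k"
    by (simp_all add: M_def B_def C_def Y_def)
  have X4: "X = four_block_mat M B C Y"
    using XC Kd by (intro eq_matI) (auto simp: M_def B_def C_def Y_def)
  have S4: "S = four_block_mat (diag_mat_of r c) (0\<^sub>m r k) (0\<^sub>m m r) (0\<^sub>m m k)"
    using Kd by (intro eq_matI) (auto simp: S_def diag_mat_of_def)
  define \<Q> where "\<Q> = {four_block_mat (U * diag_mat_of r q * transpose_mat U) (0\<^sub>m r k) (0\<^sub>m m r) V
      | U V. orthogonal_mat r U \<and> block_supported c r U \<and> stiefel m k V}"
  have "Qset d K r p s q = \<Q>"
    unfolding \<Q>_def k_def m_def by (rule Qset_eq[OF assms(10-12) ce inj])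
  then have Qbar: "Qbar UA VA d K r p s q = (\<lambda>W. UA * W * transpose_mat VA) ` \<Q>"
    by (auto simp: Qbar_def)
  have QsetC: "W \<in> carrier_mat d K" if W: "W \<in> \<Q>" for W
  proof -
    obtain U V where "W = four_block_mat (U * diag_mat_of r q * transpose_mat U) (0\<^sub>m r k) (0\<^sub>m m r) V"
      and U: "orthogonal_mat r U" and V: "stiefel m k V"
      using W by (auto simp: \<Q>_def)
    moreover have "U * diag_mat_of r q * transpose_mat U \<in> carrier_mat r r"
      using U mult_carrier_mat[OF _ diag_mat_of_carrier, of U r r q] by (auto simp: orthogonal_mat_def)
    moreover have "V \<in> carrier_mat m k" using V by (simp add: stiefel_def)
    ultimately show ?thesis using Kd by simp
  qed
  have D: "dist_set Q (Qbar UA VA d K r p s q) = Inf ((\<lambda>W. frob_norm (X - W)) ` \<Q>)"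
    unfolding dist_set_def Qbar image_image using dist QsetC by (intro arg_cong[of _ _ Inf] image_cong) auto
  have "orthogonal_mat r (1\<^sub>m r)" "block_supported c r (1\<^sub>m r)"
    by (auto simp: orthogonal_mat_def block_supported_def)
  then have "\<Q> \<noteq> {}" using stiefel_nonempty[OF km] by (auto simp: \<Q>_def)
  \<comment> \<open>An infimum below 1 over a nonempty set yields an actual point closer than 1;
    whether the infimum is attained is left open.\<close>
  with near obtain W0 where "W0 \<in> \<Q>" "frob_norm (X - W0) < 1"
    unfolding D by (auto dest: cInf_lessD[rotated])
  then obtain U0 V0 where U0: "orthogonal_mat r U0" "block_supported c r U0" and V0: "stiefel m k V0"
    and n0: "frob_norm (X - four_block_mat (U0 * diag_mat_of r q * transpose_mat U0) (0\<^sub>m r k) (0\<^sub>m m r) V0) < 1"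
    by (auto simp: \<Q>_def)
  have V0C: "V0 \<in> carrier_mat m k" using V0 by (simp add: stiefel_def)
  have iso: "transpose_mat (four_block_mat M B C Y) * four_block_mat M B C Y = 1\<^sub>m (r + k)"
    using XtX by (simp add: X4 Kd)
  have q': "q l = 1 \<or> q l = - 1" if "l < r" for l using q that by simp
  obtain W where W: "W \<in> \<Q>"
    and le: "(a r)\<^sup>2 * (frob_norm (X - W))\<^sup>2 \<le> (9 / 2 + 12 * \<iota>) * (frob_norm (S - X * transpose_mat S * X))\<^sup>2"
    using error_bound_four_block[where q = q and c = c and \<alpha> = "a r" and \<iota> = \<iota>,
        OF bc iso q' U0 V0C n0[unfolded X4] assms(9) c_ge \<iota>(1) gap]
    unfolding X4 S4 \<Q>_def by blast
  \<comment> \<open>The infimum, bounded below by 0, is at most the value at the constructed point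
    \<open>W\<close>.\<close>
  have "dist_set Q (Qbar UA VA d K r p s q) \<le> frob_norm (X - W)"
    unfolding D by (intro cInf_lower imageI W bdd_belowI2[of _ 0]) auto
  also have "\<dots> \<le> kappa a s p r * frob_norm (S - X * transpose_mat S * X)"
    using kappa_bound[OF assms(9) _ \<open>1 \<le> p\<close> _ _ le[unfolded \<iota>_def]] \<iota>(1) by (simp add: \<iota>_def)
  finally show "dist_set Q (Qbar UA VA d K r p s q) \<le> kappa a s p r * frob_norm (A - Q * transpose_mat A * Q)"
    unfolding residual .
qed

end
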